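(* Let $z:V\to\mathbb{C}$ be a realization of a simply connected triangular mesh $M=(V,E,F)$ and let $h:V\to\mathbb{R}$ be a function. Then the following are equivalent: (a) $h$ is harmonic with respect to the cotangent Laplacian, i.e. for every interior vertex $i\in V_{int}$ $$\sum_{j}(\cot\beta_{ij}^{k}+\cot\beta_{ji}^{l})(h_j-h_i)=0,$$ where the sum is over all vertices $j$ adjacent to $i$, and for each such $j$, $\{ijk\}$ and $\{jil\}$ denote the left and right faces of the oriented edge $e_{ij}$. (b) There exists an infinitesimal conformal deformation $\dot z:V\to\mathbb{C}$ of $z$ with scale change at vertices $h$. It is unique up to infinitesimal rotations and translations (i.e. up to adding maps of the form $i\theta z+c$ with $\theta\in\mathbb{R}$, $c\in\mathbb{C}$). (c) There exists a map $\dot z:V\to\mathbb{C}$ such that $i\dot z$ is an infinitesimal pattern deformation of $z$ with angular velocities $h$. The deformation $i\dot z$ is unique up to infinitesimal scalings and translations (i.e. up to adding maps of the form $rz+c$ with $r\in\mathbb{R}$, $c\in\mathbb{C}$).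
   Context: A triangular mesh $M$ is an oriented simplicial complex whose underlying topological space is a connected 2-manifold (possibly with boundary); $V,E,F$ are its sets of vertices, edges and triangles, and $V_{int}$, $E_{int}$ the sets of interior vertices and interior edges. A realization is a map $z:V\to\mathbb{C}$ such that for each triangle $\{ijk\}\in F$ the points $z_i,z_j,z_k$ are not collinear. For an interior edge oriented from $i$ to $j$ (written $e_{ij}$), its left face is denoted $\{ijk\}$ and its right face $\{jil\}$. $\beta_{ij}^{k}$ denotes the angle at vertex $k$ (opposite the edge $ij$) in the realized triangle $z_i,z_j,z_k$, and $\beta_{ji}^{l}$ the angle at $l$ in the triangle $z_j,z_i,z_l$; angles lie in $(0,\pi)$ up to sign, with positive sign if $z$ maps the (oriented) triangle to a positively oriented triangle of $\mathbb{C}$ and negative sign otherwise. An infinitesimal conformal deformation of $z$ is a map $\dot z:V\to\mathbb{C}$ for which there exists $u:V\to\mathbb{R}$ (the scale change at vertices) with $\operatorname{Re}\frac{\dot z_j-\dot z_i}{z_j-z_i}=\frac{u_i+u_j}{2}$ for every edge $\{ij\}$. An infinitesimal pattern deformation of $z$ is a map $\dot z:V\to\mathbb{C}$ for which there exists $\alpha:V\to\mathbb{R}$ (the angular velocities at vertices) with $\operatorname{Im}\frac{\dot z_j-\dot z_i}{z_j-z_i}=\frac{\alpha_i+\alpha_j}{2}$ for every edge $\{ij\}$. The letter $i$ also denotes the imaginary unit when used as a factor. *)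

theory Defs
  imports "HOL-Analysis.Analysis"
begin

section \<open>Triangular meshes\<close>

text \<open>
  A two-dimensional simplicial complex is given by its set \<open>K\<close> of simplices. Its vertices, edges
  and triangles are the simplices with one, two and three elements. No finiteness is required.
\<close>

definition simplicial_complex2 :: "'v set set \<Rightarrow> bool" where
  "simplicial_complex2 K \<longleftrightarrow>
     (\<forall>s\<in>K. finite s \<and> s \<noteq> {} \<and> card s \<le> 3) \<and>
     (\<forall>s\<in>K. \<forall>t. t \<subseteq> s \<and> t \<noteq> {} \<longrightarrow> t \<in> K)"

definition vertices :: "'v set set \<Rightarrow> 'v set" where
  "vertices K = {v. {v} \<in> K}"

definition adjacent :: "'v set set \<Rightarrow> 'v \<Rightarrow> 'v \<Rightarrow> bool" where
  "adjacent K i j \<longleftrightarrow> i \<noteq> j \<and> {i, j} \<in> K"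

definition is_face :: "'v set set \<Rightarrow> 'v \<Rightarrow> 'v \<Rightarrow> 'v \<Rightarrow> bool" where
  "is_face K i j k \<longleftrightarrow> distinct [i, j, k] \<and> {i, j, k} \<in> K"

text \<open>
  The underlying topological space, in barycentric coordinates, with the topology of pointwise
  convergence. On a locally finite complex this is the usual (weak) topology. Local finiteness
  need not be assumed separately: in either topology, if the space is a manifold it is locally
  compact, which forces every vertex to lie in only finitely many simplices.
\<close>

definition underlying_space :: "'v set set \<Rightarrow> ('v \<Rightarrow> real) set" where
  "underlying_space K =
     {x. (\<forall>v. 0 \<le> x v) \<and> {v. x v \<noteq> 0} \<in> K \<and> (\<Sum>v | x v \<noteq> 0. x v) = 1}"

definition vertex_point :: "'v \<Rightarrow> 'v \<Rightarrow> real" where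
  "vertex_point v = (\<lambda>w. if w = v then 1 else 0)"

definition closed_half_plane :: "complex set" where
  "closed_half_plane = {w. 0 \<le> Im w}"

text \<open>\<open>locally_modelled_at S H x\<close>: the point \<open>x\<close> has an open neighbourhood in \<open>S\<close> that is
  homeomorphic to an open subset of \<open>H\<close>.\<close>

definition locally_modelled_at ::
  "'a::topological_space set \<Rightarrow> complex set \<Rightarrow> 'a \<Rightarrow> bool" where
  "locally_modelled_at S H x \<longleftrightarrow>
     (\<exists>U W. openin (top_of_set S) U \<and> x \<in> U \<and> openin (top_of_set H) W \<and> U homeomorphic W)"

definition surface_with_boundary :: "'a::topological_space set \<Rightarrow> bool" where
  "surface_with_boundary S \<longleftrightarrow>
     Hausdorff_space (top_of_set S) \<and> second_countable (top_of_set S) \<and>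
     (\<forall>x\<in>S. locally_modelled_at S closed_half_plane x)"

text \<open>
  An orientation is the set \<open>T\<close> of positively ordered triangles \<open>(i, j, k)\<close>: of the two cyclic
  orders of each triangle it selects exactly one, and two different triangles with a common edge
  induce opposite directions on it (so a directed edge has at most one triangle on its left).
\<close>

definition orientation :: "'v set set \<Rightarrow> ('v \<times> 'v \<times> 'v) set \<Rightarrow> bool" where
  "orientation K T \<longleftrightarrow>
     (\<forall>i j k. (i, j, k) \<in> T \<longrightarrow> is_face K i j k \<and> (j, k, i) \<in> T) \<and>
     (\<forall>i j k. is_face K i j k \<longrightarrow> ((i, j, k) \<in> T \<longleftrightarrow> (j, i, k) \<notin> T)) \<and>
     (\<forall>i j k l. (i, j, k) \<in> T \<and> (i, j, l) \<in> T \<longrightarrow> k = l)"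

definition triangular_mesh :: "'v set set \<Rightarrow> ('v \<times> 'v \<times> 'v) set \<Rightarrow> bool" where
  "triangular_mesh K T \<longleftrightarrow>
     simplicial_complex2 K \<and> orientation K T \<and>
     connected (underlying_space K) \<and> surface_with_boundary (underlying_space K)"

text \<open>Interior vertices are those that are interior points of the manifold.\<close>

definition interior_vertices :: "'v set set \<Rightarrow> 'v set" where
  "interior_vertices K =
     {v \<in> vertices K. locally_modelled_at (underlying_space K) UNIV (vertex_point v)}"

text \<open>The third vertex of the left face of the edge from \<open>i\<close> to \<open>j\<close>. The right face of that edge
  is the left face of the edge from \<open>j\<close> to \<open>i\<close>.\<close>

definition left_apex :: "('v \<times> 'v \<times> 'v) set \<Rightarrow> 'v \<Rightarrow> 'v \<Rightarrow> 'v" where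
  "left_apex T i j = (THE k. (i, j, k) \<in> T)"


section \<open>Realizations and the cotangent Laplacian\<close>

definition realization :: "'v set set \<Rightarrow> ('v \<Rightarrow> complex) \<Rightarrow> bool" where
  "realization K z \<longleftrightarrow> (\<forall>i j k. is_face K i j k \<longrightarrow> \<not> collinear {z i, z j, z k})"

text \<open>
  The signed angle at \<open>c\<close> in the triangle \<open>a, b, c\<close>. As \<open>Arg\<close> takes values in \<open>]-\<pi>, \<pi>]\<close>, for a
  nondegenerate triangle this is the angle in \<open>]0, \<pi>[\<close> between \<open>a - c\<close> and \<open>b - c\<close>, with positive
  sign if \<open>a, b, c\<close> is counterclockwise and with negative sign otherwise.
\<close>

definition signed_angle :: "complex \<Rightarrow> complex \<Rightarrow> complex \<Rightarrow> real" where
  "signed_angle a b c = Arg ((b - c) / (a - c))"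

definition cot_weight ::
  "('v \<times> 'v \<times> 'v) set \<Rightarrow> ('v \<Rightarrow> complex) \<Rightarrow> 'v \<Rightarrow> 'v \<Rightarrow> real" where
  "cot_weight T z i j =
     (let k = left_apex T i j; l = left_apex T j i
      in cot (signed_angle (z i) (z j) (z k)) + cot (signed_angle (z j) (z i) (z l)))"

definition cot_harmonic ::
  "'v set set \<Rightarrow> ('v \<times> 'v \<times> 'v) set \<Rightarrow> ('v \<Rightarrow> complex) \<Rightarrow> ('v \<Rightarrow> real) \<Rightarrow> bool" where
  "cot_harmonic K T z h \<longleftrightarrow>
     (\<forall>i\<in>interior_vertices K. (\<Sum>j | adjacent K i j. cot_weight T z i j * (h j - h i)) = 0)"


section \<open>Infinitesimal deformations\<close>

definition conformal_deformation ::
  "'v set set \<Rightarrow> ('v \<Rightarrow> complex) \<Rightarrow> ('v \<Rightarrow> complex) \<Rightarrow> ('v \<Rightarrow> real) \<Rightarrow> bool" where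
  "conformal_deformation K z zdot u \<longleftrightarrow>
     (\<forall>i j. adjacent K i j \<longrightarrow> Re ((zdot j - zdot i) / (z j - z i)) = (u i + u j) / 2)"

definition pattern_deformation ::
  "'v set set \<Rightarrow> ('v \<Rightarrow> complex) \<Rightarrow> ('v \<Rightarrow> complex) \<Rightarrow> ('v \<Rightarrow> real) \<Rightarrow> bool" where
  "pattern_deformation K z zdot \<alpha> \<longleftrightarrow>
     (\<forall>i j. adjacent K i j \<longrightarrow> Im ((zdot j - zdot i) / (z j - z i)) = (\<alpha> i + \<alpha> j) / 2)"

end

theory Submission
  imports Defs
begin

text \<open>
  On each edge a conformal deformation with scale change \<open>h\<close> is determined by its angular velocity.
  In a triangle at a vertex \<open>v\<close> the angular velocities of the two edges at \<open>v\<close> must differ by a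
  fixed combination of the two adjacent cotangents and the differences of \<open>h\<close>. Going once around an
  interior vertex these jumps add up to half the cotangent Laplacian of \<open>h\<close>; so harmonicity is
  necessary, and it suffices to deform the star of each vertex. Two such local deformations differ on
  the common triangles by an infinitesimal rotation and translation, that is by a 1-cocycle with
  values in \<open>\<real> \<times> \<complex>\<close>, and on a simply connected mesh this cocycle is exact.

  The combinatorial structure of the mesh (local finiteness, every simplex lies in a triangle, links
  are connected, a vertex is interior iff all its edges have two faces) is extracted from the
  topology of the underlying space by invariance of domain.
\<close>

section \<open>Exactness on simply connected spaces\<close>

text \<open>The mesh hypotheses are purely topological and the vertex set may be infinite, so no
  combinatorics is available at the start. The space right at a vertex is the hard case, since how
  its triangles fit together is what has to be found out. To tell interior from boundary, the proof
  therefore steps off the vertex to a nearby point of the star of one edge, where barycentric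
  coordinates can be compared with a chart. Taking values in \<real> \<times> \<complex> integrates
  rotation and displacement at once. Simple connectivity speaks of continuous loops while the
  cocycle is discrete; they meet in the cover by open stars, whose members have a common point
  exactly when their vertices span a simplex.\<close>

lemma diff_eq_diff_swap: "a - b = c - d \<longleftrightarrow> b - d = a - (c::'a::ab_group_add)"
  by (auto simp: algebra_simps)

text \<open>A flat bundle with fibre \<open>'g\<close> in disguise: \<open>F i\<close> and
  \<open>F j\<close> differ by a constant on the whole overlap, so only increments have a meaning,
  and the question is whether they have monodromy. The \<open>F i\<close> may be discontinuous; the
  later application, where they come from a choice of vertices, relies on this.\<close>

locale local_primitives =
  fixes S :: "'a::topological_space set" and I :: "'i set"
    and U :: "'i \<Rightarrow> 'a set" and F :: "'i \<Rightarrow> 'a \<Rightarrow> 'g::ab_group_add"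
  assumes open_U: "i \<in> I \<Longrightarrow> openin (top_of_set S) (U i)"
    and cover: "S \<subseteq> (\<Union>i\<in>I. U i)"
    and compat: "\<lbrakk>i \<in> I; j \<in> I; x \<in> U i \<inter> U j; y \<in> U i \<inter> U j\<rbrakk> \<Longrightarrow> F i y - F i x = F j y - F j x"
begin

definition local_increment :: "'a \<Rightarrow> 'a \<Rightarrow> 'g \<Rightarrow> bool" where
  "local_increment x y \<alpha> \<longleftrightarrow> (\<exists>i\<in>I. x \<in> U i \<and> y \<in> U i \<and> \<alpha> = F i y - F i x)"

text \<open>A primitive of the system pulled back along \<open>p\<close>. The uniform \<delta>
  survives reparametrization and restriction to slices, so a Lebesgue number is invoked only in the
  existence proof.\<close>

definition primitive_on :: "'b::metric_space set \<Rightarrow> ('b \<Rightarrow> 'a) \<Rightarrow> ('b \<Rightarrow> 'g) \<Rightarrow> bool" where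
  "primitive_on Q p G \<longleftrightarrow>
     (\<exists>\<delta>>0. \<forall>s\<in>Q. \<forall>t\<in>Q. dist s t < \<delta> \<longrightarrow> local_increment (p s) (p t) (G t - G s))"

lemma local_increment_unique:
  "local_increment x y \<alpha> \<Longrightarrow> local_increment x y \<beta> \<Longrightarrow> \<alpha> = \<beta>"
  unfolding local_increment_def using compat by blast

lemma local_increment_refl: "local_increment x x \<alpha> \<Longrightarrow> \<alpha> = 0"
  unfolding local_increment_def by auto

text \<open>The set is contracted to a base point along segments cut into steps below the Lebesgue
  number, and the increments along the segment to \<open>x\<close> are added up. Compact convex sets
  include both the interval of a path and the square of a homotopy.\<close>

lemma primitive_exists:
  fixes p :: "'b::real_normed_vector \<Rightarrow> 'a"
  assumes "compact Q" "convex Q" and contp: "continuous_on Q p" and pS: "p \<in> Q \<rightarrow> S"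
  shows "\<exists>G. primitive_on Q p G"
proof (cases "Q = {}")
  case True
  then show ?thesis unfolding primitive_on_def by (auto intro!: exI[of _ 1])
next
  case False
  then obtain o' where o': "o' \<in> Q" by blast
  have "\<exists>V. open V \<and> Q \<inter> p -` U i = Q \<inter> V" if i: "i \<in> I" for i
  proof -
    have "openin (top_of_set Q) (Q \<inter> p -` U i)"
      using continuous_openin_preimage[OF contp pS open_U[OF i]] .
    then show ?thesis by (auto simp: openin_open)
  qed
  then obtain O' where O': "\<And>i. i \<in> I \<Longrightarrow> open (O' i)" "\<And>i. i \<in> I \<Longrightarrow> Q \<inter> p -` U i = Q \<inter> O' i"
    by metis
  have "Q \<subseteq> \<Union> (O' ` I)"
  proof
    fix x assume "x \<in> Q"
    moreover then obtain i where "i \<in> I" "p x \<in> U i" using cover pS by blast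
    ultimately show "x \<in> \<Union> (O' ` I)" using O'(2)[of i] by auto
  qed
  then obtain e where e: "e > 0" "\<And>x. x \<in> Q \<Longrightarrow> \<exists>B \<in> O' ` I. ball x e \<subseteq> B"
    using Heine_Borel_lemma[OF \<open>compact Q\<close>, of "O' ` I"] O'(1) by (metis imageE)
  have ex_i: "\<exists>i\<in>I. \<forall>y\<in>Q. dist x y < e \<longrightarrow> p y \<in> U i" if x: "x \<in> Q" for x
  proof -
    obtain i where "i \<in> I" "ball x e \<subseteq> O' i" using e(2)[OF x] by blast
    then show ?thesis using O'(2)[of i] by (auto simp: subset_iff)
  qed
  define D where "D s t = (SOME \<alpha>. local_increment (p s) (p t) \<alpha>)" for s t
  have D_eq: "D s t = \<alpha>" if "local_increment (p s) (p t) \<alpha>" for s t \<alpha>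
    unfolding D_def using local_increment_unique[OF that] that by (metis someI)
  have D_add: "D s t + D t r = D s r"
    if x: "x \<in> Q" and m: "s \<in> Q" "t \<in> Q" "r \<in> Q" "dist x s < e" "dist x t < e" "dist x r < e" for x s t r
  proof -
    obtain i where i: "i \<in> I" "\<forall>y\<in>Q. dist x y < e \<longrightarrow> p y \<in> U i" using ex_i[OF x] by blast
    have "D s t = F i (p t) - F i (p s)" "D t r = F i (p r) - F i (p t)" "D s r = F i (p r) - F i (p s)"
      using i m by (auto intro!: D_eq bexI[of _ i] simp: local_increment_def)
    then show ?thesis by simp
  qed
  obtain B where B: "\<And>x. x \<in> Q \<Longrightarrow> norm (x - o') \<le> B"
  proof -
    obtain B where "\<And>x. x \<in> Q \<Longrightarrow> norm x \<le> B"
      using compact_imp_bounded[OF \<open>compact Q\<close>] by (auto simp: bounded_iff)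
    then have "norm (x - o') \<le> B + B" if "x \<in> Q" for x
      using norm_triangle_ineq4[of x o'] that o' by (meson add_mono order_trans)
    then show ?thesis using that by blast
  qed
  \<comment> \<open>Each piece of a segment becomes shorter than \<open>e / 2\<close>, which leaves
    room to move its end point by another \<open>e / 2\<close>.\<close>
  obtain N :: nat where N: "2 * B / e < real N" "N > 0"
    using reals_Archimedean2[of "max 1 (2 * B / e)"] by (metis max_less_iff_conj of_nat_0_less_iff zero_less_one less_trans)
  define \<gamma> where "\<gamma> k x = o' + (real k / real N) *\<^sub>R (x - o')" for k x
  have \<gamma>Q: "\<gamma> k x \<in> Q" if "k \<le> N" "x \<in> Q" for k x
  proof -
    have "\<gamma> k x = (1 - real k / real N) *\<^sub>R o' + (real k / real N) *\<^sub>R x"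
      by (simp add: \<gamma>_def algebra_simps)
    moreover have "real k / real N \<le> 1" using that N by simp
    ultimately show ?thesis
      using convexD_alt[OF \<open>convex Q\<close> o' that(2), of "real k / real N"] by simp
  qed
  have \<gamma>1: "dist (\<gamma> k x) (\<gamma> (Suc k) x) < e / 2" if "x \<in> Q" for k x
  proof -
    have "\<gamma> (Suc k) x - \<gamma> k x = (1 / real N) *\<^sub>R (x - o')"
      by (simp add: \<gamma>_def add_divide_distrib algebra_simps)
    then have "norm (\<gamma> (Suc k) x - \<gamma> k x) = norm (x - o') / real N" by simp
    then have "dist (\<gamma> k x) (\<gamma> (Suc k) x) = norm (x - o') / real N"
      by (metis dist_norm dist_commute)
    also have "\<dots> \<le> B / real N" using B[OF that] by (simp add: divide_right_mono)
    also have "\<dots> < e / 2" using N e by (simp add: field_simps)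
    finally show ?thesis .
  qed
  have \<gamma>2: "dist (\<gamma> k x) (\<gamma> k y) \<le> dist x y" if "k \<le> N" for k x y
  proof -
    have "\<gamma> k x - \<gamma> k y = (real k / real N) *\<^sub>R (x - y)"
      by (simp add: \<gamma>_def algebra_simps)
    then have "dist (\<gamma> k x) (\<gamma> k y) = (real k / real N) * dist x y"
      by (simp add: dist_norm)
    also have "\<dots> \<le> 1 * dist x y" using that N by (intro mult_right_mono) auto
    finally show ?thesis by simp
  qed
  define G where "G x = (\<Sum>k<N. D (\<gamma> k x) (\<gamma> (Suc k) x))" for x
  have GD: "G y - G x = D x y" if xy: "x \<in> Q" "y \<in> Q" "dist x y < e / 2" for x y
  proof -
    \<comment> \<open>The increments around the quadrilateral between consecutive points of the two
      segments cancel, so the difference of the two sums telescopes.\<close>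
    have "D (\<gamma> k y) (\<gamma> (Suc k) y) - D (\<gamma> k x) (\<gamma> (Suc k) x)
        = D (\<gamma> (Suc k) x) (\<gamma> (Suc k) y) - D (\<gamma> k x) (\<gamma> k y)" if k: "k < N" for k
    proof -
      let ?c = "\<gamma> k x"
      have m: "\<gamma> k x \<in> Q" "\<gamma> (Suc k) x \<in> Q" "\<gamma> k y \<in> Q" "\<gamma> (Suc k) y \<in> Q"
        using \<gamma>Q k xy by auto
      have d: "dist ?c (\<gamma> k x) < e" "dist ?c (\<gamma> (Suc k) x) < e" "dist ?c (\<gamma> k y) < e" "dist ?c (\<gamma> (Suc k) y) < e"
        using \<gamma>1[OF xy(1), of k] \<gamma>2[of k x y] \<gamma>2[of "Suc k" x y] k xy e
          dist_triangle[of ?c "\<gamma> (Suc k) y" "\<gamma> (Suc k) x"] by auto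
      have "D (\<gamma> k x) (\<gamma> (Suc k) x) + D (\<gamma> (Suc k) x) (\<gamma> (Suc k) y) = D (\<gamma> k x) (\<gamma> (Suc k) y)"
        "D (\<gamma> k x) (\<gamma> k y) + D (\<gamma> k y) (\<gamma> (Suc k) y) = D (\<gamma> k x) (\<gamma> (Suc k) y)"
        using D_add[OF m(1)] m d by blast+
      moreover have "\<lbrakk>a + b = c; d + e = c\<rbrakk> \<Longrightarrow> e - a = b - d" for a b c d e :: 'g
        by (auto simp: algebra_simps)
      ultimately show ?thesis by blast
    qed
    then have "G y - G x = (\<Sum>k<N. D (\<gamma> (Suc k) x) (\<gamma> (Suc k) y) - D (\<gamma> k x) (\<gamma> k y))"
      by (simp add: G_def flip: sum_subtractf)
    also have "\<dots> = D (\<gamma> N x) (\<gamma> N y) - D (\<gamma> 0 x) (\<gamma> 0 y)"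
      by (rule sum_lessThan_telescope)
    finally have "G y - G x = D (\<gamma> N x) (\<gamma> N y) - D (\<gamma> 0 x) (\<gamma> 0 y)" .
    moreover have "\<gamma> N x = x" "\<gamma> N y = y" "\<gamma> 0 x = o'" "\<gamma> 0 y = o'"
      using N by (auto simp: \<gamma>_def)
    moreover have "D o' o' = 0" using D_add[of o' o' o' o'] o' e by simp
    ultimately show ?thesis by simp
  qed
  have "primitive_on Q p G"
    unfolding primitive_on_def
  proof (intro exI[of _ "e/2"] conjI ballI impI)
    fix s t assume st: "s \<in> Q" "t \<in> Q" "dist s t < e / 2"
    obtain i where i: "i \<in> I" "\<forall>y\<in>Q. dist s y < e \<longrightarrow> p y \<in> U i" using ex_i[OF st(1)] by blast
    then have "local_increment (p s) (p t) (F i (p t) - F i (p s))"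
      using st e(1) by (auto intro!: bexI[of _ i] simp: local_increment_def)
    then show "local_increment (p s) (p t) (G t - G s)" using D_eq GD[OF st] by metis
  qed (use e in auto)
  then show ?thesis by blast
qed

text \<open>Close points have the same increment under both primitives, so their difference is
  locally constant on a connected set.\<close>

lemma primitive_unique:
  assumes "primitive_on Q p G" "primitive_on Q p H" "connected Q" "s \<in> Q" "t \<in> Q"
  shows "G t - G s = H t - H s"
proof -
  obtain d where d: "d > 0" "\<forall>s\<in>Q. \<forall>t\<in>Q. dist s t < d \<longrightarrow> local_increment (p s) (p t) (G t - G s)"
    using assms(1) by (auto simp: primitive_on_def)
  obtain e where e: "e > 0" "\<forall>s\<in>Q. \<forall>t\<in>Q. dist s t < e \<longrightarrow> local_increment (p s) (p t) (H t - H s)"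
    using assms(2) by (auto simp: primitive_on_def)
  have "(\<lambda>x. G x - H x) s = (\<lambda>x. G x - H x) t"
  proof (rule connected_local_const[OF assms(3-5)], rule ballI)
    fix a assume a: "a \<in> Q"
    have "G b - G a = H b - H a" if "b \<in> Q" "dist b a < min d e" for b
      using d(2) e(2) that a by (intro local_increment_unique[of "p a" "p b"]) (auto simp: dist_commute)
    then have "G a - H a = G b - H b" if "b \<in> Q" "dist b a < min d e" for b
      using that diff_eq_diff_swap by blast
    then show "\<forall>\<^sub>F b in at a within Q. G a - H a = G b - H b"
      unfolding eventually_at using d(1) e(1) by (intro exI[of _ "min d e"]) auto
  qed
  then show ?thesis by (simp add: algebra_simps)
qed

section \<open>Increments along paths and loops\<close>

definition path_increment :: "(real \<Rightarrow> 'a) \<Rightarrow> 'g \<Rightarrow> bool" where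
  "path_increment p \<alpha> \<longleftrightarrow> (\<exists>G. primitive_on {0..1} p G \<and> \<alpha> = G 1 - G 0)"

lemma path_increment_unique:
  "path_increment p \<alpha> \<Longrightarrow> path_increment p \<beta> \<Longrightarrow> \<alpha> = \<beta>"
  unfolding path_increment_def using primitive_unique[of "{0..1::real}" p _ _ 0 1] by auto

lemma path_increment_exists:
  assumes "path p" "path_image p \<subseteq> S"
  shows "\<exists>\<alpha>. path_increment p \<alpha>"
  using primitive_exists[of "{0..1}" p] assms
  by (auto simp: path_increment_def path_def path_image_def)

lemma primitive_on_affine:
  fixes c m :: real
  assumes "primitive_on Q p G" "\<And>t. t \<in> Q' \<Longrightarrow> c + m * t \<in> Q" "\<And>t. t \<in> Q' \<Longrightarrow> q t = p (c + m * t)"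
  shows "primitive_on Q' q (\<lambda>t. G (c + m * t))"
proof -
  obtain d where d: "d > 0" "\<forall>s\<in>Q. \<forall>t\<in>Q. dist s t < d \<longrightarrow> local_increment (p s) (p t) (G t - G s)"
    using assms(1) by (auto simp: primitive_on_def)
  have "local_increment (q s) (q t) (G (c + m * t) - G (c + m * s))"
    if "s \<in> Q'" "t \<in> Q'" "dist s t < d / (\<bar>m\<bar> + 1)" for s t
  proof -
    have "dist (c + m * s) (c + m * t) = \<bar>m\<bar> * dist s t"
      by (simp add: dist_real_def flip: abs_mult right_diff_distrib)
    also have "\<dots> \<le> (\<bar>m\<bar> + 1) * dist s t" by (simp add: mult_right_mono)
    also have "\<dots> < d" using that(3) by (simp add: field_simps)
    finally show ?thesis using d(2) that assms(2,3) by auto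
  qed
  then show ?thesis
    unfolding primitive_on_def using d(1) by (intro exI[of _ "d / (\<bar>m\<bar> + 1)"]) auto
qed

lemma path_increment_join:
  assumes "path_increment (p +++ q) \<gamma>" "pathfinish p = pathstart q"
  shows "\<exists>\<alpha> \<beta>. path_increment p \<alpha> \<and> path_increment q \<beta> \<and> \<gamma> = \<alpha> + \<beta>"
proof -
  obtain G where G: "primitive_on {0..1} (p +++ q) G" "\<gamma> = G 1 - G 0"
    using assms by (auto simp: path_increment_def)
  have "primitive_on {0..1} p (\<lambda>t. G (0 + (1/2) * t))"
    by (rule primitive_on_affine[OF G(1)]) (auto simp: joinpaths_def)
  then have 1: "path_increment p (G (1/2) - G 0)"
    unfolding path_increment_def by (intro exI conjI) auto
  have "primitive_on {0..1} q (\<lambda>t. G (1/2 + (1/2) * t))"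
    by (rule primitive_on_affine[OF G(1)])
      (use assms(2) in \<open>auto simp: joinpaths_def pathfinish_def pathstart_def algebra_simps\<close>)
  then have 2: "path_increment q (G 1 - G (1/2))"
    unfolding path_increment_def by (intro exI conjI) auto
  show ?thesis using 1 2 G(2) by (intro exI conjI) auto
qed

lemma path_increment_reversepath:
  assumes "path_increment p \<alpha>"
  shows "path_increment (reversepath p) (- \<alpha>)"
proof -
  obtain G where G: "primitive_on {0..1} p G" "\<alpha> = G 1 - G 0"
    using assms by (auto simp: path_increment_def)
  have "primitive_on {0..1} (reversepath p) (\<lambda>t. G (1 + (-1) * t))"
    by (rule primitive_on_affine[OF G(1)]) (auto simp: reversepath_def)
  then show ?thesis unfolding path_increment_def using G(2) by (intro exI conjI) auto
qed

lemma path_increment_local: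
  assumes "i \<in> I" "path_image p \<subseteq> U i"
  shows "path_increment p (F i (pathfinish p) - F i (pathstart p))"
  unfolding path_increment_def primitive_on_def local_increment_def using assms
  by (intro exI[of _ "\<lambda>t. F i (p t)"] conjI exI[of _ 1] ballI impI bexI[of _ i])
    (auto simp: pathfinish_def pathstart_def path_image_def)

text \<open>Along a free homotopy \<open>H s\<close> of loops the increment of \<open>H s\<close> does not depend on \<open>s\<close>, because
  both ends of a loop move together; at a constant loop it vanishes.\<close>

lemma path_increment_loop:
  assumes "simply_connected S" "path p" "path_image p \<subseteq> S" "pathfinish p = pathstart p"
    and inc: "path_increment p \<alpha>"
  shows "\<alpha> = 0"
proof -
  define a where "a = pathstart p"
  have "a \<in> S" using assms by (auto simp: a_def)
  then have "homotopic_loops S p (\<lambda>_. a)"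
    using assms unfolding simply_connected_def
    by (elim allE[of _ p] allE[of _ "\<lambda>_. a"])
      (auto simp: path_def pathfinish_def pathstart_def path_image_def)
  then obtain H :: "real \<times> real \<Rightarrow> 'a" where H: "continuous_on ({0..1} \<times> {0..1}) H"
    "H \<in> {0..1} \<times> {0..1} \<rightarrow> S" "\<And>t. t \<in> {0..1} \<Longrightarrow> H (0, t) = p t"
    "\<And>t. t \<in> {0..1} \<Longrightarrow> H (1, t) = a" "\<And>s. s \<in> {0..1} \<Longrightarrow> H (s, 1) = H (s, 0)"
    unfolding homotopic_loops by (auto simp: pathfinish_def pathstart_def o_def image_subset_iff)
  let ?Q = "{0..1::real} \<times> {0..1::real}"
  obtain G where G: "primitive_on ?Q H G"
    using primitive_exists[OF _ _ H(1,2)] by (auto simp: compact_Times convex_Times)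
  then obtain d where d: "d > 0" "\<And>s t. s \<in> ?Q \<Longrightarrow> t \<in> ?Q \<Longrightarrow> dist s t < d \<Longrightarrow> local_increment (H s) (H t) (G t - G s)"
    unfolding primitive_on_def by meson
  have side: "primitive_on {0..1} (\<lambda>t. H (s, t)) (\<lambda>t. G (s, t))" if "s \<in> {0..1}" for s
    unfolding primitive_on_def
  proof (intro exI[of _ d] conjI ballI impI d)
    fix t t' :: real assume "t \<in> {0..1}" "t' \<in> {0..1}" "dist t t' < d"
    then show "(s, t) \<in> ?Q" "(s, t') \<in> ?Q" "dist (s, t) (s, t') < d"
      using that by (auto simp: dist_Pair_Pair)
  qed
  have "(\<lambda>s. G (s, 1) - G (s, 0)) 0 = (\<lambda>s. G (s, 1) - G (s, 0)) 1"
  proof (rule connected_local_const[of "{0..1::real}"], goal_cases)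
    case 4
    show ?case
    proof
      fix s :: real assume s: "s \<in> {0..1}"
      have "G (s', 1) - G (s, 1) = G (s', 0) - G (s, 0)" if s': "s' \<in> {0..1}" "dist s' s < d" for s'
      proof (rule local_increment_unique)
        show "local_increment (H (s, 0)) (H (s', 0)) (G (s', 0) - G (s, 0))"
          using s s' by (intro d) (auto simp: dist_Pair_Pair dist_commute)
        have "local_increment (H (s, 1)) (H (s', 1)) (G (s', 1) - G (s, 1))"
          using s s' by (intro d) (auto simp: dist_Pair_Pair dist_commute)
        then show "local_increment (H (s, 0)) (H (s', 0)) (G (s', 1) - G (s, 1))"
          using H(5) s s' by simp
      qed
      then have "G (s, 1) - G (s, 0) = G (s', 1) - G (s', 0)" if "s' \<in> {0..1}" "dist s' s < d" for s'
        using that diff_eq_diff_swap by blast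
      then show "\<forall>\<^sub>F s' in at s within {0..1}. G (s, 1) - G (s, 0) = G (s', 1) - G (s', 0)"
        unfolding eventually_at using d(1) by (intro exI[of _ d]) auto
    qed
  qed auto
  moreover have "path_increment p (G (0, 1) - G (0, 0))"
  proof -
    have "primitive_on {0..1} p (\<lambda>t. G (0, t))"
      using side[of 0] H(3) by (auto simp: primitive_on_def)
    then show ?thesis by (auto simp: path_increment_def)
  qed
  then have "\<alpha> = G (0, 1) - G (0, 0)" using inc path_increment_unique by blast
  moreover have "G (1, 1) - G (1, 0) = 0"
  proof -
    have a: "primitive_on {0..1} (\<lambda>t. H (1, t)) (\<lambda>t. G (1, t))" using side[of 1] by simp
    then have "primitive_on {0..1} (\<lambda>t. H (1, t)) (\<lambda>t. 0)"
      unfolding primitive_on_def using H(4) local_increment_refl by (metis (no_types, lifting) diff_self)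
    from primitive_unique[OF a this, of 0 1] show ?thesis by simp
  qed
  ultimately show ?thesis by simp
qed

text \<open>\<open>g\<close> is the increment along a chosen path from a base point. The paths to
  \<open>x\<close> and \<open>y\<close> close up through a path inside \<open>U i\<close>, which is
  why the \<open>U i\<close> are path connected, and the resulting loop has increment 0.\<close>

lemma global_primitive:
  assumes sc: "simply_connected S"
    and pc: "\<And>i. i \<in> I \<Longrightarrow> path_connected (U i)"
  obtains g where "\<And>i x y. i \<in> I \<Longrightarrow> x \<in> U i \<Longrightarrow> y \<in> U i \<Longrightarrow> g y - g x = F i y - F i x"
proof (cases "S = {}")
  case True
  then have "U i = {}" if "i \<in> I" for i using open_U[OF that] by auto
  then show ?thesis using that by blast
next
  case False
  then obtain a where a: "a \<in> S" by blast
  have "\<exists>p. path p \<and> path_image p \<subseteq> S \<and> pathstart p = a \<and> pathfinish p = x" if x: "x \<in> S" for x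
  proof -
    \<comment> \<open>\<open>simply_connected\<close> makes any two loops freely homotopic; for
      constant loops the track of one point under the homotopy is a path between them.\<close>
    have "homotopic_loops S (\<lambda>_. a) (\<lambda>_. x)"
      using sc x a unfolding simply_connected_def
      by (elim allE[of _ "\<lambda>_. a"] allE[of _ "\<lambda>_. x"])
        (auto simp: path_def pathfinish_def pathstart_def path_image_def)
    then obtain H :: "real \<times> real \<Rightarrow> 'a" where H: "continuous_on ({0..1} \<times> {0..1}) H"
      "H \<in> {0..1} \<times> {0..1} \<rightarrow> S" "\<And>t. t \<in> {0..1} \<Longrightarrow> H (0, t) = a"
      "\<And>t. t \<in> {0..1} \<Longrightarrow> H (1, t) = x"
      unfolding homotopic_loops by (auto simp: pathfinish_def pathstart_def o_def image_subset_iff)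
    have "continuous_on {0..1} (\<lambda>s. H (s, 0))"
      by (rule continuous_on_compose2[OF H(1)]) (auto intro!: continuous_intros)
    then show ?thesis using H(2-4)
      by (intro exI[of _ "\<lambda>s. H (s, 0)"]) (auto simp: path_def path_image_def pathstart_def pathfinish_def)
  qed
  then obtain P where P: "\<And>x. x \<in> S \<Longrightarrow> path (P x) \<and> path_image (P x) \<subseteq> S \<and> pathstart (P x) = a \<and> pathfinish (P x) = x"
    by metis
  have "\<exists>\<alpha>. path_increment (P x) \<alpha>" if "x \<in> S" for x
    using path_increment_exists P[OF that] by blast
  then obtain g where g: "\<And>x. x \<in> S \<Longrightarrow> path_increment (P x) (g x)" by metis
  have "g y - g x = F i y - F i x" if i: "i \<in> I" and xy: "x \<in> U i" "y \<in> U i" for i x y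
  proof -
    have US: "U i \<subseteq> S" using open_U[OF i] by (simp add: openin_imp_subset)
    then have S: "x \<in> S" "y \<in> S" using xy by auto
    obtain r where r: "path r" "path_image r \<subseteq> U i" "pathstart r = x" "pathfinish r = y"
      using pc[OF i] xy unfolding path_connected_def by metis
    let ?l = "P x +++ (r +++ reversepath (P y))"
    have l: "path ?l" "path_image ?l \<subseteq> S" "pathfinish ?l = pathstart ?l"
      using P[OF S(1)] P[OF S(2)] r US
      by (simp_all add: subset_path_image_join path_image_reversepath order_trans[OF r(2) US])
    then obtain \<gamma> where \<gamma>: "path_increment ?l \<gamma>" using path_increment_exists by blast
    then have "\<gamma> = 0" using path_increment_loop[OF sc] l by blast
    obtain \<alpha> \<beta> where 1: "path_increment (P x) \<alpha>" "path_increment (r +++ reversepath (P y)) \<beta>" "\<gamma> = \<alpha> + \<beta>"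
      using path_increment_join[OF \<gamma>] P[OF S(1)] r by auto
    obtain \<beta>1 \<beta>2 where 2: "path_increment r \<beta>1" "path_increment (reversepath (P y)) \<beta>2" "\<beta> = \<beta>1 + \<beta>2"
      using path_increment_join[OF 1(2)] P[OF S(2)] r by auto
    have "\<alpha> = g x" "\<beta>2 = - g y" "\<beta>1 = F i y - F i x"
      using 1 2 g S path_increment_unique path_increment_reversepath path_increment_local[OF i r(2)] r
      by blast+
    then have "(g x + (F i y - F i x)) - g y = 0"
      using \<open>\<gamma> = 0\<close> 1(3) 2(3) by (simp add: add_diff_eq)
    then show ?thesis by (metis add_diff_cancel_left' right_minus_eq)
  qed
  then show ?thesis using that by blast
qed

end

section \<open>Triangles and difference equations on cycles\<close>

lemma cot_Arg: "w \<noteq> 0 \<Longrightarrow> cot (Arg w) = Re w / Im w"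
  by (simp add: cot_def cos_Arg sin_Arg)

lemma Im_divide_eq_0_collinear:
  fixes a b c :: complex
  assumes "Im ((b - a) / (c - b)) = 0" "b \<noteq> c"
  shows "collinear {a, b, c}"
proof -
  have "b - a = of_real (Re ((b - a) / (c - b))) * (c - b)"
  proof -
    have "of_real (Re ((b - a) / (c - b))) = (b - a) / (c - b)"
      using assms by (simp add: complex_is_Real_iff of_real_Re)
    then show ?thesis using assms by (simp only:) simp
  qed
  then have "a - b = - Re ((b - a) / (c - b)) *\<^sub>R (c - b)" by (simp add: scaleR_conv_of_real algebra_simps)
  then have "collinear {0, c - b, a - b}" unfolding collinear_lemma by blast
  then show ?thesis using collinear_3[of a b c] by (simp add: insert_commute)
qed

text \<open>Dividing by the third side leaves one complex parameter
  \<open>w = (b - a) / (c - b)\<close>: the sides become \<open>w\<close>, \<open>1 + w\<close> and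
  1, and the angles at \<open>b\<close> and \<open>c\<close> are the arguments of \<open>- w\<close>
  and \<open>inverse (1 + w)\<close>. The condition is affine in \<open>\<beta> - \<alpha>\<close>
  with slope \<open>- Im w\<close>, which is nonzero for a nondegenerate triangle.\<close>

lemma third_side_conformal_iff:
  fixes a b c da db dc :: complex and ha hb hc \<alpha> \<beta> :: real
  assumes nc: "\<not> collinear {a, b, c}"
    and db: "db = da + (b - a) * (of_real ((ha + hb) / 2) + \<i> * of_real \<alpha>)"
    and dc: "dc = da + (c - a) * (of_real ((ha + hc) / 2) + \<i> * of_real \<beta>)"
  shows "Re ((dc - db) / (c - b)) = (hb + hc) / 2 \<longleftrightarrow>
    \<beta> = \<alpha> + (cot (signed_angle a b c) * (hb - ha) + cot (signed_angle c a b) * (hc - ha)) / 2"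
proof -
  have ne: "a \<noteq> b" "b \<noteq> c" "a \<noteq> c" using nc by (auto simp: insert_commute)
  define w where "w = (b - a) / (c - b)"
  have Imw: "Im w \<noteq> 0" using Im_divide_eq_0_collinear nc ne unfolding w_def by blast
  have ba: "b - a = w * (c - b)" using ne by (simp add: w_def)
  have ca: "c - a = (1 + w) * (c - b)" using ne by (simp add: w_def field_simps)
  have w0: "w \<noteq> 0" "1 + w \<noteq> 0" using ba ca ne by auto
  have "dc - db = (c - b) * ((1 + w) * (of_real ((ha + hc) / 2) + \<i> * of_real \<beta>) - w * (of_real ((ha + hb) / 2) + \<i> * of_real \<alpha>))"
  proof -
    have "dc - db = (c - a) * (of_real ((ha + hc) / 2) + \<i> * of_real \<beta>) - (b - a) * (of_real ((ha + hb) / 2) + \<i> * of_real \<alpha>)"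
      unfolding db dc by simp
    moreover have "u * d * P - v * d * Q = d * (u * P - v * Q)" for u v d P Q :: complex
      by (simp add: algebra_simps)
    ultimately show ?thesis unfolding ba ca by simp
  qed
  then have q: "(dc - db) / (c - b) = (1 + w) * (of_real ((ha + hc) / 2) + \<i> * of_real \<beta>) - w * (of_real ((ha + hb) / 2) + \<i> * of_real \<alpha>)"
    using ne by simp
  have "(a - b) / (c - b) = - w" using ne by (simp add: w_def field_simps)
  then have cb: "cot (signed_angle c a b) = Re w / Im w"
    using w0 cot_Arg[of "-w"] by (simp add: signed_angle_def)
  have "(b - c) / (a - c) = inverse (1 + w)"
    using ne w0 ca by (simp add: field_simps)
  then have "cot (signed_angle a b c) = Re (inverse (1 + w)) / Im (inverse (1 + w))"
    using w0 cot_Arg[of "inverse (1 + w)"] by (simp add: signed_angle_def)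
  also have "\<dots> = - (1 + Re w) / Im w"
  proof -
    have "Re (inverse u) / Im (inverse u) = - Re u / Im u" if "Im u \<noteq> 0" for u
      using that by (simp add: sum_power2_eq_zero_iff)
    from this[of "1 + w"] show ?thesis using Imw by simp
  qed
  finally have cc: "cot (signed_angle a b c) = - (1 + Re w) / Im w" .
  show ?thesis unfolding q cb cc using Imw by (auto simp: field_simps)
qed

text \<open>The orbit of a start point (without predecessor, if there is one) exhausts \<open>N\<close>, so the
  difference equation is solved by summation along it; only if the orbit closes up there is a
  condition.\<close>

lemma partial_cycle_difference_equation:
  fixes \<tau> :: "'a \<Rightarrow> real"
  assumes fin: "finite N" and "D \<subseteq> N" and inj: "inj_on s D" and sN: "s ` D \<subseteq> N"
    and conn: "\<And>X. X \<subseteq> N \<Longrightarrow> X \<noteq> {} \<Longrightarrow> (\<And>j. j \<in> D \<Longrightarrow> j \<in> X \<longleftrightarrow> s j \<in> X) \<Longrightarrow> X = N"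
    and tot: "D = N \<Longrightarrow> (\<Sum>j\<in>N. \<tau> j) = 0"
  obtains f where "\<And>j. j \<in> D \<Longrightarrow> f (s j) = f j + \<tau> j"
proof (cases "N = {}")
  case True
  then show ?thesis using that \<open>D \<subseteq> N\<close> by blast
next
  case False
  obtain j0 where j0: "j0 \<in> N" "s ` D \<noteq> N \<Longrightarrow> j0 \<notin> s ` D" using False sN by blast
  let ?o = "\<lambda>k. (s ^^ k) j0"
  define R where "R k \<longleftrightarrow> (\<forall>m<k. ?o m \<in> D)" for k
  have R0: "R 0" by (simp add: R_def)
  have RS: "R (Suc k) \<longleftrightarrow> R k \<and> ?o k \<in> D" for k by (auto simp: R_def less_Suc_eq)
  have Rmono: "R k \<Longrightarrow> m \<le> k \<Longrightarrow> R m" for m k by (auto simp: R_def)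
  have RN: "R k \<Longrightarrow> ?o k \<in> N" for k
    by (cases k) (use j0 sN in \<open>auto simp: RS\<close>)
  define X where "X = {?o k |k. R k}"
  \<comment> \<open>A predecessor of \<open>j0\<close> forces, by the choice of \<open>j0\<close>,
    that \<open>s\<close> is onto \<open>N\<close>; counting then makes \<open>s\<close> a
    permutation of \<open>N\<close>.\<close>
  have closes: "s ` D = N \<and> D = N" if "j \<in> D" "s j = j0" for j
  proof -
    have sD: "s ` D = N" using j0(2) that by blast
    then have "card D = card N" using card_image[OF inj] by simp
    then show ?thesis using sD card_subset_eq[OF fin \<open>D \<subseteq> N\<close>] by simp
  qed
  have "X = N"
  proof (rule conn)
    show "X \<subseteq> N" using RN by (auto simp: X_def)
    show "X \<noteq> {}" using R0 by (auto simp: X_def)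
    fix j assume j: "j \<in> D"
    show "j \<in> X \<longleftrightarrow> s j \<in> X"
    proof
      assume "j \<in> X"
      then obtain k where "R k" "j = ?o k" by (auto simp: X_def)
      then have "R (Suc k)" "s j = ?o (Suc k)" using j by (auto simp: RS)
      then show "s j \<in> X" unfolding X_def by blast
    next
      assume "s j \<in> X"
      then obtain k where k: "R k" "s j = ?o k" by (auto simp: X_def)
      show "j \<in> X"
      proof (cases k)
        case (Suc m)
        then have "?o m \<in> D" "R m" "s j = s (?o m)" using k by (auto simp: RS)
        then have "j = ?o m" using inj j by (auto dest: inj_onD)
        then show ?thesis using \<open>R m\<close> by (auto simp: X_def)
      next
        case 0
        then have D: "s ` D = N" "D = N" using closes[OF j] k by auto
        have R: "R k" for k by (induction k) (use D RN R0 in \<open>auto simp: RS\<close>)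
        have "\<not> inj ?o"
        proof
          assume "inj ?o"
          moreover have "finite (range ?o)" using RN R fin by (auto intro: finite_subset)
          ultimately show False using finite_imageD by blast
        qed
        \<comment> \<open>By injectivity of \<open>s\<close> a repetition in the orbit can be moved
          back step by step until it involves \<open>j0\<close>; the predecessor of
          \<open>j0\<close> is then an orbit point.\<close>
        then obtain u t where "u < t" "?o u = ?o t"
          unfolding inj_on_def by (metis linorder_neqE_nat)
        then have "\<exists>t>0. ?o t = j0"
        proof (induction u arbitrary: t)
          case 0
          then show ?case by auto
        next
          case (Suc u)
          then obtain t' where t': "t = Suc t'" "u < t'" by (cases t) auto
          then have "s (?o u) = s (?o t')" using Suc by simp
          then have "?o u = ?o t'" using R[of "Suc u"] R[of "Suc t'"] inj by (auto simp: RS dest: inj_onD)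
          then show ?case using Suc t' by blast
        qed
        then obtain t where "t > 0" "?o t = j0" by blast
        then obtain t' where "s (?o t') = s j" using k 0 by (cases t) auto
        then have "j = ?o t'" using inj j R[of "Suc t'"] by (auto simp: RS dest: inj_onD)
        then show ?thesis using R by (auto simp: X_def)
      qed
    qed
  qed
  define idx where "idx j = (LEAST k. R k \<and> ?o k = j)" for j
  have idx: "R (idx j) \<and> ?o (idx j) = j" if "j \<in> N" for j
  proof -
    have "j \<in> X" using that \<open>X = N\<close> by simp
    then obtain k where "R k \<and> ?o k = j" unfolding X_def by blast
    then show ?thesis unfolding idx_def by (rule LeastI)
  qed
  have idx_le: "idx (?o k) \<le> k" if "R k" for k
    unfolding idx_def by (rule Least_le) (use that in auto)
  define f where "f j = (\<Sum>k<idx j. \<tau> (?o k))" for j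
  have "f (s j) = f j + \<tau> j" if j: "j \<in> D" for j
  proof (cases "idx (s j) = Suc (idx j)")
    case True
    then show ?thesis using idx[of j] j \<open>D \<subseteq> N\<close> by (auto simp: f_def)
  next
    case False
    \<comment> \<open>The first visit to \<open>s j\<close> fails to come one step after that to
      \<open>j\<close> only where the orbit closes up, that is for \<open>s j = j0\<close>. There
      \<open>f (s j)\<close> is an empty sum, and the equation says that the sum over one full turn
      vanishes.\<close>
    have jN: "j \<in> N" "s j \<in> N" using j \<open>D \<subseteq> N\<close> sN by auto
    have "R (Suc (idx j))" "?o (Suc (idx j)) = s j" using idx[OF jN(1)] j by (auto simp: RS)
    then have le: "idx (s j) \<le> idx j" using idx_le False by (metis le_Suc_eq)
    have 0: "idx (s j) = 0"
    proof (rule ccontr)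
      assume "idx (s j) \<noteq> 0"
      then obtain m where m: "idx (s j) = Suc m" by (cases "idx (s j)") auto
      then have "?o m \<in> D" "R m" "s (?o m) = s j" using idx[OF jN(2)] by (auto simp: RS)
      then have "j = ?o m" using inj j by (auto dest: inj_onD)
      then have "idx j \<le> m" using idx_le[OF \<open>R m\<close>] by simp
      then show False using le m by simp
    qed
    then have sj: "s j = j0" using idx[OF jN(2)] by simp
    then have DN: "D = N" using closes[OF j] by blast
    have img: "?o ` {..idx j} = N"
    proof (rule conn)
      have Rk: "R k" if "k \<le> idx j" for k using Rmono idx[OF jN(1)] that by blast
      show "?o ` {..idx j} \<subseteq> N" using Rk RN by auto
      show "?o ` {..idx j} \<noteq> {}" by auto
      fix i assume i: "i \<in> D"
      show "i \<in> ?o ` {..idx j} \<longleftrightarrow> s i \<in> ?o ` {..idx j}"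
      proof
        assume "i \<in> ?o ` {..idx j}"
        then obtain k where k: "k \<le> idx j" "i = ?o k" by auto
        show "s i \<in> ?o ` {..idx j}"
        proof (cases "k = idx j")
          case True
          then have "s i = ?o 0" using k idx[OF jN(1)] sj by simp
          then show ?thesis by blast
        next
          case False
          then have "s i = ?o (Suc k)" "Suc k \<le> idx j" using k by auto
          then show ?thesis by blast
        qed
      next
        assume "s i \<in> ?o ` {..idx j}"
        then obtain k where k: "k \<le> idx j" "s i = ?o k" by auto
        show "i \<in> ?o ` {..idx j}"
        proof (cases k)
          case 0
          then have "i = j" using k sj inj i j by (auto dest: inj_onD)
          then have "i = ?o (idx j)" using idx[OF jN(1)] by simp
          then show ?thesis by blast
        next
          case (Suc m)
          then have "?o m \<in> D" "s i = s (?o m)" using k Rk[of k] by (auto simp: RS)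
          then have "i = ?o m" using inj i by (auto dest: inj_onD)
          then show ?thesis using Suc k by auto
        qed
      qed
    qed
    \<comment> \<open>A repetition up to \<open>idx j\<close> would be a shortcut reaching
      \<open>j\<close> before \<open>idx j\<close>.\<close>
    have inj_o: "inj_on ?o {..idx j}"
    proof (rule linorder_inj_onI)
      fix x y assume xy: "x < y" "x \<in> {..idx j}" "y \<in> {..idx j}"
      show "?o x \<noteq> ?o y"
      proof
        assume eq: "?o x = ?o y"
        have "j = ?o (idx j - y + y)" using xy idx[OF jN(1)] by simp
        also have "\<dots> = (s ^^ (idx j - y)) (?o y)" by (simp add: funpow_add)
        also have "\<dots> = (s ^^ (idx j - y)) (?o x)" using eq by simp
        also have "\<dots> = ?o (idx j - y + x)" by (simp add: funpow_add)
        finally have "?o (idx j - y + x) = j" by simp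
        moreover have "R (idx j - y + x)" using Rmono[of "idx j"] idx[OF jN(1)] xy by auto
        ultimately have "idx j \<le> idx j - y + x" using idx_le by metis
        then show False using xy by auto
      qed
    qed auto
    have "(\<Sum>k\<le>idx j. \<tau> (?o k)) = (\<Sum>j\<in>N. \<tau> j)"
      using sum.reindex[OF inj_o, of \<tau>] img by simp
    then have "f j + \<tau> j = 0"
      using tot[OF DN] idx[OF jN(1)] by (simp add: f_def flip: lessThan_Suc_atMost)
    then show ?thesis using 0 by (simp add: f_def)
  qed
  then show ?thesis using that by blast
qed

section \<open>The underlying space of a complex\<close>

lemma homeomorphic_openE:
  assumes "openin (top_of_set S) U" "openin (top_of_set H) W" "U homeomorphic W"
  obtains \<phi> \<psi> where "homeomorphism U W \<phi> \<psi>"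
    "\<And>V. openin (top_of_set S) V \<Longrightarrow> openin (top_of_set H) (\<phi> ` (U \<inter> V))"
    "\<And>V. openin (top_of_set H) V \<Longrightarrow> openin (top_of_set S) (\<psi> ` (W \<inter> V))"
proof -
  obtain \<phi> \<psi> where h: "homeomorphism U W \<phi> \<psi>" using assms(3) by (auto simp: homeomorphic_def)
  have "openin (top_of_set H) (\<phi> ` (U \<inter> V))" if "openin (top_of_set S) V" for V
  proof -
    have "openin (top_of_set U) (U \<inter> V)"
      using that assms(1) by (meson openin_Int openin_imp_subset openin_subset_trans inf_le1)
    then show ?thesis using homeomorphism_imp_open_map[OF h] assms(2) openin_trans by blast
  qed
  moreover have "openin (top_of_set S) (\<psi> ` (W \<inter> V))" if "openin (top_of_set H) V" for V
  proof -
    have "openin (top_of_set W) (W \<inter> V)"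
      using that assms(2) by (meson openin_Int openin_imp_subset openin_subset_trans inf_le1)
    then show ?thesis using homeomorphism_imp_open_map[OF homeomorphism_symD[OF h]] assms(1) openin_trans by blast
  qed
  ultimately show ?thesis using that h by blast
qed

text \<open>Invariance of domain concerns maps on open subsets of the plane, whereas
  \<open>f\<close> is defined on a piece of the space. Composing with the inverse chart
  \<open>\<psi>\<close> brings it into that form.\<close>

lemma inj_image_open_via_homeomorphism:
  fixes f :: "'a::topological_space \<Rightarrow> complex"
  assumes h: "homeomorphism U (W :: complex set) \<phi> \<psi>" and "open V" "V \<subseteq> \<phi> ` (U \<inter> N)"
    and f: "continuous_on N f" "inj_on f N"
  shows "open (f ` \<psi> ` V)" "\<psi> ` V \<subseteq> N"
proof -
  have VW: "V \<subseteq> W" using assms h by (auto simp: homeomorphism_def)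
  show N: "\<psi> ` V \<subseteq> N" using assms(3) h by (auto simp: homeomorphism_def)
  have "continuous_on V \<psi>" using h VW by (meson continuous_on_subset homeomorphism_def)
  then have "continuous_on V (f \<circ> \<psi>)"
    using f(1) N by (meson continuous_on_compose continuous_on_subset)
  moreover have "inj_on (f \<circ> \<psi>) V"
  proof (rule comp_inj_on)
    show "inj_on \<psi> V" using h VW by (intro inj_on_inverseI[of _ \<phi>]) (auto simp: homeomorphism_def)
    show "inj_on f (\<psi> ` V)" using f(2) N by (rule inj_on_subset)
  qed
  ultimately show "open (f ` \<psi> ` V)"
    using invariance_of_domain[of V "f \<circ> \<psi>"] \<open>open V\<close> by (simp add: image_comp)
qed

text \<open>The point itself may lie on the boundary, but every neighbourhood of it has points that
  the chart sends into the open half plane. This rules out pieces that embed in a line.\<close>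

lemma modelled_half_plane_interior_image:
  fixes f :: "'a::topological_space \<Rightarrow> complex"
  assumes "locally_modelled_at S closed_half_plane x" and N: "openin (top_of_set S) N" "x \<in> N"
    and f: "continuous_on N f" "inj_on f N"
  shows "interior (f ` N) \<noteq> {}"
proof -
  obtain U W where UW: "openin (top_of_set S) U" "x \<in> U" "openin (top_of_set closed_half_plane) W" "U homeomorphic W"
    using assms(1) by (auto simp: locally_modelled_at_def)
  obtain \<phi> \<psi> where h: "homeomorphism U W \<phi> \<psi>"
    "\<And>V. openin (top_of_set S) V \<Longrightarrow> openin (top_of_set closed_half_plane) (\<phi> ` (U \<inter> V))"
    "\<And>V. openin (top_of_set closed_half_plane) V \<Longrightarrow> openin (top_of_set S) (\<psi> ` (W \<inter> V))"
    by (rule homeomorphic_openE[OF UW(1,3,4)]) (rule that)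
  obtain V where V: "open V" "\<phi> ` (U \<inter> N) = closed_half_plane \<inter> V"
    using h(2)[OF N(1)] by (auto simp: openin_open)
  let ?V = "V \<inter> {w. 0 < Im w}"
  have w: "\<phi> x \<in> V" "0 \<le> Im (\<phi> x)" using V(2) UW N by (auto simp: closed_half_plane_def)
  then obtain e where e: "e > 0" "ball (\<phi> x) e \<subseteq> V" using V(1) open_contains_ball by blast
  have "\<phi> x + \<i> * of_real (e / 2) \<in> ?V" using e w by (auto simp: subset_iff dist_norm norm_mult)
  moreover have "open ?V" using V(1) by (intro open_Int open_halfspace_Im_gt)
  moreover have "?V \<subseteq> \<phi> ` (U \<inter> N)" using V(2) by (auto simp: closed_half_plane_def)
  ultimately have "?V \<noteq> {}" "f ` \<psi> ` ?V \<subseteq> interior (f ` N)"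
    using inj_image_open_via_homeomorphism[OF h(1) _ _ f, of ?V]
    by (blast, intro interior_maximal image_mono)
  then show ?thesis by blast
qed

text \<open>Here the chart image is open in the plane, so the given point itself goes to an interior
  point. This is the test that tells interior from boundary points.\<close>

lemma modelled_plane_interior_image:
  fixes f :: "'a::topological_space \<Rightarrow> complex"
  assumes "locally_modelled_at S UNIV x" and N: "openin (top_of_set S) N" "x \<in> N"
    and f: "continuous_on N f" "inj_on f N"
  shows "f x \<in> interior (f ` N)"
proof -
  obtain U and W :: "complex set"
    where UW: "openin (top_of_set S) U" "x \<in> U" "openin (top_of_set UNIV) W" "U homeomorphic W"
    using assms(1) unfolding locally_modelled_at_def by blast
  obtain \<phi> \<psi> where h: "homeomorphism U W \<phi> \<psi>"
    "\<And>V. openin (top_of_set S) V \<Longrightarrow> openin (top_of_set UNIV) (\<phi> ` (U \<inter> V))"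
    "\<And>V. openin (top_of_set UNIV) V \<Longrightarrow> openin (top_of_set S) (\<psi> ` (W \<inter> V))"
    by (rule homeomorphic_openE[OF UW(1,3,4)]) (rule that)
  let ?V = "\<phi> ` (U \<inter> N)"
  have "open ?V" using h(2)[OF N(1)] by simp
  note * = inj_image_open_via_homeomorphism[OF h(1) this order_refl f]
  have "x \<in> \<psi> ` ?V" using h(1) UW N by (force simp: homeomorphism_def)
  then show ?thesis using * by (meson image_eqI image_mono interiorI)
qed

lemma interior_subset_half_plane:
  fixes A :: "complex set"
  assumes "A \<subseteq> {w. 0 \<le> Im w}" "w \<in> interior A"
  shows "0 < Im w"
proof -
  obtain e where e: "e > 0" "ball w e \<subseteq> A" using assms(2) by (auto simp: mem_interior)
  have "w - \<i> * of_real (e / 2) \<in> A" using e by (auto simp: subset_iff dist_norm norm_mult)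
  then show ?thesis using assms(1) e(1) by auto
qed

section \<open>Barycentric coordinates and open stars\<close>

definition edge_point :: "'v \<Rightarrow> 'v \<Rightarrow> real \<Rightarrow> 'v \<Rightarrow> real" where
  "edge_point v j t = (\<lambda>w. if w = v then 1 - t else if w = j then t else 0)"

lemma underlying_spaceD:
  assumes "x \<in> underlying_space K"
  shows "0 \<le> x v" "{v. x v \<noteq> 0} \<in> K" "(\<Sum>v | x v \<noteq> 0. x v) = 1"
  using assms by (auto simp: underlying_space_def)

locale complex2 =
  fixes K :: "'v set set"
  assumes simplicial: "simplicial_complex2 K"
begin

lemma simplex_finite: "s \<in> K \<Longrightarrow> finite s"
  and simplex_nonempty: "s \<in> K \<Longrightarrow> s \<noteq> {}"
  and simplex_card: "s \<in> K \<Longrightarrow> card s \<le> 3"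
  and simplex_subset: "s \<in> K \<Longrightarrow> t \<subseteq> s \<Longrightarrow> t \<noteq> {} \<Longrightarrow> t \<in> K"
  using simplicial unfolding simplicial_complex2_def by blast+

lemma underlying_spaceI:
  assumes "s \<in> K" "\<And>v. 0 \<le> x v" "\<And>v. v \<notin> s \<Longrightarrow> x v = 0" "(\<Sum>v\<in>s. x v) = 1"
  shows "x \<in> underlying_space K"
proof -
  have sub: "{v. x v \<noteq> 0} \<subseteq> s" using assms(3) by blast
  have "(\<Sum>v | x v \<noteq> 0. x v) = (\<Sum>v\<in>s. x v)"
    by (rule sum.mono_neutral_left[OF simplex_finite[OF assms(1)] sub]) auto
  moreover have "{v. x v \<noteq> 0} \<noteq> {}" using assms(4) by (metis (mono_tags) empty_Collect_eq sum.neutral zero_neq_one)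
  ultimately show ?thesis
    using assms simplex_subset[OF assms(1) sub] by (simp add: underlying_space_def)
qed

lemma sum_superset_support:
  assumes "x \<in> underlying_space K" "\<And>v. x v \<noteq> 0 \<Longrightarrow> v \<in> s" "finite s"
  shows "(\<Sum>v\<in>s. x v) = 1"
proof -
  have "(\<Sum>v | x v \<noteq> 0. x v) = (\<Sum>v\<in>s. x v)"
    by (rule sum.mono_neutral_left[OF assms(3)]) (use assms(2) in auto)
  then show ?thesis using underlying_spaceD(3)[OF assms(1)] by simp
qed

lemma support_subset_simplex:
  assumes "x \<in> underlying_space K" "\<And>v. v \<in> s \<Longrightarrow> x v \<noteq> 0" "s \<noteq> {}"
  shows "s \<in> K"
  using simplex_subset[OF underlying_spaceD(2)[OF assms(1)]] assms by blast

lemma vertex_point_in_space: "v \<in> vertices K \<Longrightarrow> vertex_point v \<in> underlying_space K"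
  by (rule underlying_spaceI[of "{v}"]) (auto simp: vertices_def vertex_point_def)

lemma edge_point_in_space:
  "adjacent K v j \<Longrightarrow> 0 \<le> t \<Longrightarrow> t \<le> 1 \<Longrightarrow> edge_point v j t \<in> underlying_space K"
  by (rule underlying_spaceI[of "{v, j}"]) (auto simp: adjacent_def edge_point_def)

lemma adjacent_sym: "adjacent K v j \<Longrightarrow> adjacent K j v"
  by (auto simp: adjacent_def insert_commute)

lemma adjacent_vertices: "adjacent K v j \<Longrightarrow> v \<in> vertices K \<and> j \<in> vertices K"
  using simplex_subset[of "{v, j}"] by (auto simp: adjacent_def vertices_def)

lemma face_adjacent:
  assumes "is_face K i j k"
  shows "adjacent K i j" "adjacent K j k" "adjacent K i k"
  using assms simplex_subset[of "{i, j, k}" "{i, j}"] simplex_subset[of "{i, j, k}" "{j, k}"]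
    simplex_subset[of "{i, j, k}" "{i, k}"] by (auto simp: is_face_def adjacent_def)

text \<open>The edge points tend to the vertex coordinatewise as \<open>t\<close> tends to 0. This
  is the device for passing from a vertex to the relative interior of one of its edges.\<close>

lemma vertex_nbhd_meets_edge:
  assumes "openin (top_of_set (underlying_space K)) U" "vertex_point v \<in> U" "adjacent K v j"
  shows "\<exists>t. 0 < t \<and> t < 1 \<and> edge_point v j t \<in> U"
proof -
  obtain V where V: "open V" "U = underlying_space K \<inter> V" using assms(1) by (auto simp: openin_open)
  have "continuous_on UNIV (\<lambda>t. edge_point v j t)"
  proof (rule continuous_on_coordinatewise_then_product)
    show "continuous_on UNIV (\<lambda>t. edge_point v j t w)" for w
      by (cases "w = v"; cases "w = j") (auto simp: edge_point_def intro!: continuous_intros)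
  qed
  then have "open ((\<lambda>t. edge_point v j t) -` V)" using V(1) by (simp add: open_vimage)
  moreover have "edge_point v j 0 = vertex_point v" by (auto simp: edge_point_def vertex_point_def)
  then have "0 \<in> (\<lambda>t. edge_point v j t) -` V" using assms(2) V by simp
  ultimately obtain e where e: "e > 0" "ball 0 e \<subseteq> (\<lambda>t. edge_point v j t) -` V"
    by (meson open_contains_ball)
  define t where "t = min (e/2) (1/2)"
  have "0 < t" "t < 1" "t < e" using e by (auto simp: t_def)
  then have "edge_point v j t \<in> V" using e(2) by (auto simp: subset_iff)
  then show ?thesis using V(2) edge_point_in_space[OF assms(3), of t] \<open>0 < t\<close> \<open>t < 1\<close> by auto
qed

definition open_star :: "'v \<Rightarrow> ('v \<Rightarrow> real) set" where
  "open_star v = {x \<in> underlying_space K. x v \<noteq> 0}"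

lemma openin_nonzero_coordinates:
  assumes "finite s"
  shows "openin (top_of_set (underlying_space K)) {x \<in> underlying_space K. \<forall>v\<in>s. x v \<noteq> 0}"
proof -
  have "open {x :: 'v \<Rightarrow> real. x v \<noteq> 0}" for v
    by (intro open_Collect_neq continuous_on_product_coordinates continuous_on_const)
  then have "open (\<Inter>v\<in>s. {x :: 'v \<Rightarrow> real. x v \<noteq> 0})" using assms by (intro open_INT) auto
  moreover have "{x \<in> underlying_space K. \<forall>v\<in>s. x v \<noteq> 0} = underlying_space K \<inter> (\<Inter>v\<in>s. {x. x v \<noteq> 0})" by auto
  ultimately show ?thesis by (auto simp: openin_open)
qed

lemma openin_open_star: "openin (top_of_set (underlying_space K)) (open_star v)"
  using openin_nonzero_coordinates[of "{v}"] by (simp add: open_star_def)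

lemma vertex_point_in_open_star: "v \<in> vertices K \<Longrightarrow> vertex_point v \<in> open_star v"
  by (auto simp: open_star_def vertex_point_in_space) (simp add: vertex_point_def)

text \<open>The segment to the vertex stays in the simplex that carries \<open>x\<close>, and its
  coordinate at \<open>v\<close> stays positive.\<close>

lemma path_connected_open_star: "path_connected (open_star v)"
proof -
  have "path_component (open_star v) x (vertex_point v)" if x: "x \<in> open_star v" for x
  proof -
    let ?p = "\<lambda>t w. (1 - t) * x w + t * vertex_point v w"
    have xS: "x \<in> underlying_space K" and xv: "x v \<noteq> 0" using x by (auto simp: open_star_def)
    let ?s = "{w. x w \<noteq> 0}"
    have "?p t \<in> open_star v" if t: "0 \<le> t" "t \<le> 1" for t
    proof -
      have "(\<Sum>w\<in>?s. ?p t w) = (1 - t) * (\<Sum>w\<in>?s. x w) + t * (\<Sum>w\<in>?s. vertex_point v w)"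
        by (simp add: sum.distrib sum_distrib_left)
      also have "(\<Sum>w\<in>?s. vertex_point v w) = 1"
        using simplex_finite[OF underlying_spaceD(2)[OF xS]] xv by (simp add: vertex_point_def)
      finally have sum: "(\<Sum>w\<in>?s. ?p t w) = 1" using underlying_spaceD(3)[OF xS] by simp
      have "?p t \<in> underlying_space K"
        by (rule underlying_spaceI[OF underlying_spaceD(2)[OF xS] _ _ sum])
          (use t underlying_spaceD(1)[OF xS] xv in \<open>auto simp: vertex_point_def\<close>)
      moreover have "?p t v > 0"
      proof (cases "t = 0")
        case False
        then show ?thesis
          using t underlying_spaceD(1)[OF xS, of v] by (simp add: vertex_point_def add_nonneg_pos)
      qed (use xv underlying_spaceD(1)[OF xS, of v] in simp)
      ultimately show ?thesis by (simp add: open_star_def)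
    qed
    moreover have "path ?p"
      unfolding path_def by (intro continuous_on_coordinatewise_then_product continuous_intros)
    ultimately show ?thesis
      unfolding path_component_def
      by (intro exI[of _ ?p]) (auto simp: path_image_def pathstart_def pathfinish_def)
  qed
  then show ?thesis
    unfolding path_connected_component by (meson path_component_sym path_component_trans)
qed

end

section \<open>Closed cochains\<close>

context complex2
begin

text \<open>Turns functions on vertices into functions on the space. The choice is arbitrary, but
  inside the open star of \<open>v\<close> it always yields \<open>v\<close> or a neighbour of
  \<open>v\<close>.\<close>

definition support_vertex :: "('v \<Rightarrow> real) \<Rightarrow> 'v" where
  "support_vertex x = (SOME v. x v \<noteq> 0)"

lemma support_vertex:
  assumes "x \<in> underlying_space K"
  shows "x (support_vertex x) \<noteq> 0"
proof -
  have "\<exists>v. x v \<noteq> 0" using simplex_nonempty[OF underlying_spaceD(2)[OF assms]] by blast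
  then show ?thesis unfolding support_vertex_def by (rule someI_ex)
qed

lemma support_vertex_vertex_point [simp]: "support_vertex (vertex_point v) = v"
  by (simp add: support_vertex_def vertex_point_def)

lemma open_star_cover: "underlying_space K \<subseteq> (\<Union>v\<in>vertices K. open_star v)"
proof
  fix x assume x: "x \<in> underlying_space K"
  then have "support_vertex x \<in> vertices K"
    using support_subset_simplex[OF x, of "{support_vertex x}"] support_vertex by (auto simp: vertices_def)
  then show "x \<in> (\<Union>v\<in>vertices K. open_star v)" using x support_vertex by (auto simp: open_star_def)
qed

text \<open>The functions \<open>x \<mapsto> c v (support_vertex x)\<close> on the open stars are local primitives of the
  cochain: on a common open star two of them differ by a constant.\<close>

lemma closed_cochain_exact:
  fixes c :: "'v \<Rightarrow> 'v \<Rightarrow> 'g::ab_group_add"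
  assumes sc: "simply_connected (underlying_space K)"
    and closed: "\<And>u v w. {u, v, w} \<in> K \<Longrightarrow> c u v + c v w = c u w"
  obtains a where "\<And>v w. {v, w} \<in> K \<Longrightarrow> c v w = a w - a v"
proof -
  define F where "F v x = c v (support_vertex x)" for v x
  interpret local_primitives "underlying_space K" "vertices K" open_star F
  proof
    show "openin (top_of_set (underlying_space K)) (open_star i)" for i by (rule openin_open_star)
    show "underlying_space K \<subseteq> (\<Union>v\<in>vertices K. open_star v)" by (rule open_star_cover)
    fix i j x y
    assume xy: "x \<in> open_star i \<inter> open_star j" "y \<in> open_star i \<inter> open_star j"
    have "c i j + F j x = F i x" if "x \<in> open_star i \<inter> open_star j" for x
    proof -
      have "{i, j, support_vertex x} \<in> K"
        using support_subset_simplex[of x "{i, j, support_vertex x}"] support_vertex[of x] that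
        by (auto simp: open_star_def)
      then show ?thesis unfolding F_def by (rule closed)
    qed
    from this[OF xy(1)] this[OF xy(2)] show "F i y - F i x = F j y - F j x"
      by (metis add_diff_cancel_left)
  qed
  obtain g where g: "\<And>i x y. i \<in> vertices K \<Longrightarrow> x \<in> open_star i \<Longrightarrow> y \<in> open_star i \<Longrightarrow> g y - g x = F i y - F i x"
    using global_primitive[OF sc] path_connected_open_star by blast
  define a where "a v = g (vertex_point v)" for v
  have "c v w = a w - a v" if vw: "{v, w} \<in> K" for v w
  proof (cases "v = w")
    case True
    then show ?thesis using closed[of v v v] vw by simp
  next
    case False
    then have adj: "adjacent K v w" using vw by (simp add: adjacent_def)
    then have V: "v \<in> vertices K" "w \<in> vertices K" using adjacent_vertices by blast+
    \<comment> \<open>The midpoint lies in both open stars and so compares the two primitives. Which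
      end point \<open>support_vertex\<close> picks there is left open.\<close>
    define \<mu> where "\<mu> = edge_point v w (1/2)"
    have \<mu>: "\<mu> \<in> underlying_space K" unfolding \<mu>_def by (rule edge_point_in_space[OF adj]) auto
    then have \<mu>st: "\<mu> \<in> open_star v" "\<mu> \<in> open_star w" using False by (auto simp: open_star_def \<mu>_def edge_point_def)
    define m where "m = support_vertex \<mu>"
    have "{w, v, m} \<in> K"
      using support_subset_simplex[of \<mu> "{w, v, m}"] support_vertex[of \<mu>] \<mu>st by (auto simp: open_star_def m_def)
    then have 1: "c w v + c v m = c w m" by (rule closed)
    have 2: "c v v = 0" "c w w = 0" using closed[of v v v] closed[of w w w] V by (auto simp: vertices_def)
    have 3: "c v w + c w v = c v v" using closed[of v w v] vw by (simp add: insert_commute)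
    have 4: "g \<mu> - g (vertex_point v) = c v m - c v v"
      using g[OF V(1) vertex_point_in_open_star[OF V(1)] \<mu>st(1)] by (simp add: F_def m_def)
    have 5: "g (vertex_point w) - g \<mu> = c w w - c w m"
      using g[OF V(2) \<mu>st(2) vertex_point_in_open_star[OF V(2)]] by (simp add: F_def m_def)
    have "a w - a v = (g (vertex_point w) - g \<mu>) + (g \<mu> - g (vertex_point v))" by (simp add: a_def)
    also have "\<dots> = c v m - c w m" unfolding 4 5 by (simp add: 2)
    also have "\<dots> = - c w v" by (simp flip: 1)
    also have "\<dots> = c v w" using 3 2 by (metis eq_neg_iff_add_eq_0)
    finally show ?thesis by simp
  qed
  then show ?thesis using that by blast
qed

text \<open>In the open star of a vertex the chosen vertices equal it or are adjacent to it, so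
  \<open>q\<close> composed with \<open>support_vertex\<close> is locally constant.\<close>

lemma constant_along_edges:
  assumes "connected (underlying_space K)" and q: "\<And>v w. adjacent K v w \<Longrightarrow> q v = q w"
    and vw: "v \<in> vertices K" "w \<in> vertices K"
  shows "q v = q w"
proof -
  have "(\<lambda>x. q (support_vertex x)) (vertex_point v) = (\<lambda>x. q (support_vertex x)) (vertex_point w)"
  proof (rule connected_local_const[OF assms(1) vertex_point_in_space[OF vw(1)] vertex_point_in_space[OF vw(2)]], rule ballI)
    fix x assume x: "x \<in> underlying_space K"
    let ?v = "support_vertex x"
    have xs: "x \<in> open_star ?v" using x support_vertex by (simp add: open_star_def)
    have "q ?v = q (support_vertex y)" if y: "y \<in> open_star ?v" for y
    proof (cases "?v = support_vertex y")
      case False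
      have "{?v, support_vertex y} \<in> K"
        using support_subset_simplex[of y "{?v, support_vertex y}"] y support_vertex[of y] by (auto simp: open_star_def)
      then show ?thesis using q False by (simp add: adjacent_def)
    qed simp
    moreover obtain V where "open V" "open_star ?v = underlying_space K \<inter> V"
      using openin_open_star[of ?v] unfolding openin_open by blast
    ultimately show "\<forall>\<^sub>F y in at x within underlying_space K. q ?v = q (support_vertex y)"
      using xs unfolding eventually_at_topological by blast
  qed
  then show ?thesis by simp
qed

end

section \<open>The local structure of a mesh\<close>

locale mesh =
  fixes K :: "'v set set" and T :: "('v \<times> 'v \<times> 'v) set"
  assumes mesh: "triangular_mesh K T"
begin

sublocale complex2 K
  using mesh by unfold_locales (simp add: triangular_mesh_def)

lemma orientation: "orientation K T"
  and connected_space: "connected (underlying_space K)"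
  and surface: "surface_with_boundary (underlying_space K)"
  using mesh by (simp_all add: triangular_mesh_def)

lemma modelled: "x \<in> underlying_space K \<Longrightarrow> locally_modelled_at (underlying_space K) closed_half_plane x"
  using surface unfolding surface_with_boundary_def by blast

lemma positive_face: "(i, j, k) \<in> T \<Longrightarrow> is_face K i j k"
  and positive_rotate: "(i, j, k) \<in> T \<Longrightarrow> (j, k, i) \<in> T"
  and positive_iff: "is_face K i j k \<Longrightarrow> (i, j, k) \<in> T \<longleftrightarrow> (j, i, k) \<notin> T"
  and positive_unique: "(i, j, k) \<in> T \<Longrightarrow> (i, j, l) \<in> T \<Longrightarrow> k = l"
  using orientation unfolding orientation_def by blast+

text \<open>If a maximal simplex had at most two vertices, its open star would be a point or an open
  segment, on which one real coordinate is injective. A half plane chart forbids this, since the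
  image would have interior points in the plane.\<close>

lemma simplex_in_face:
  assumes "s \<in> K"
  obtains i j k where "is_face K i j k" "s \<subseteq> {i, j, k}"
proof -
  define P where "P t \<longleftrightarrow> t \<in> K \<and> s \<subseteq> t" for t
  have "P s" using assms by (simp add: P_def)
  moreover have "\<forall>t. P t \<longrightarrow> card t < 4" using simplex_card by (fastforce simp: P_def)
  ultimately obtain t where t: "P t" and max: "\<And>t'. P t' \<Longrightarrow> card t' \<le> card t"
    using ex_has_greatest_nat[of P s card 4] by blast
  have tK: "t \<in> K" and fin: "finite t" and ne: "t \<noteq> {}"
    using t simplex_finite simplex_nonempty by (auto simp: P_def)
  have "card t = 3"
  proof (rule ccontr)
    assume "card t \<noteq> 3"
    moreover have "card t \<noteq> 0" using fin ne by simp
    ultimately have "card t = 1 \<or> card t = 2" using simplex_card[OF tK] by linarith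
    then obtain a b where ab: "t = {a, b}" by (metis card_1_singletonE card_2_iff insert_absorb2)
    let ?O = "{x \<in> underlying_space K. \<forall>v\<in>t. x v \<noteq> 0}"
    have supp: "{v. x v \<noteq> 0} = t" if "x \<in> ?O" for x
    proof -
      have x: "x \<in> underlying_space K" "t \<subseteq> {v. x v \<noteq> 0}" using that by auto
      then have "P {v. x v \<noteq> 0}" using t underlying_spaceD(2)[OF x(1)] by (auto simp: P_def)
      then show ?thesis using max x simplex_finite[OF underlying_spaceD(2)[OF x(1)]] card_seteq by blast
    qed
    \<comment> \<open>The barycentre of \<open>t\<close>; for a single vertex it is the degenerate
      edge from \<open>a\<close> to \<open>a\<close> at parameter 0.\<close>
    define x0 where "x0 = edge_point a b (if a = b then 0 else 1/2)"
    have "(\<Sum>v\<in>t. x0 v) = 1" unfolding ab by (cases "a = b") (auto simp: x0_def edge_point_def)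
    then have x0: "x0 \<in> ?O"
      using underlying_spaceI[OF tK, of x0] ab by (auto simp: x0_def edge_point_def split: if_splits)
    let ?f = "\<lambda>x. of_real (x a) :: complex"
    have "continuous_on ?O ?f"
      by (intro continuous_on_of_real continuous_on_subset[OF continuous_on_product_coordinates subset_UNIV])
    moreover have "inj_on ?f ?O"
    proof (rule inj_onI)
      fix x y assume xy: "x \<in> ?O" "y \<in> ?O" "?f x = ?f y"
      have "x b = (if a = b then 1 else 1 - x a) \<and> (a = b \<longrightarrow> x a = 1) \<and> (\<forall>w. w \<noteq> a \<and> w \<noteq> b \<longrightarrow> x w = 0)"
        if "x \<in> ?O" for x
        using underlying_spaceD(3)[of x K] supp[OF that] that ab by (auto split: if_splits)
      from this[OF xy(1)] this[OF xy(2)] xy(3) show "x = y" by (metis ext of_real_eq_iff)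
    qed
    ultimately have "interior (?f ` ?O) \<noteq> {}"
      using modelled_half_plane_interior_image[OF modelled openin_nonzero_coordinates[OF fin] x0] x0 by blast
    then obtain w where w: "w \<in> interior (?f ` ?O)" by blast
    have "0 < Im w" by (rule interior_subset_half_plane[OF _ w]) auto
    then show False using w interior_subset by fastforce
  qed
  then obtain i j k where "t = {i, j, k}" "distinct [i, j, k]" by (auto simp: card_3_iff)
  then show ?thesis using that t by (auto simp: P_def is_face_def)
qed

lemma edge_in_face:
  assumes "adjacent K v j"
  obtains k where "is_face K v j k"
proof -
  obtain a b c where "is_face K a b c" "{v, j} \<subseteq> {a, b, c}" "v \<noteq> j"
    using simplex_in_face[of "{v, j}"] assms by (auto simp: adjacent_def)
  then have "is_face K v j c \<or> is_face K v j a \<or> is_face K v j b"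
    by (auto simp: is_face_def insert_commute)
  then show ?thesis using that by blast
qed

section \<open>Interior and boundary near a vertex\<close>

lemma support_off_vertex:
  assumes "x \<in> underlying_space K" "x \<noteq> vertex_point v"
  obtains i where "x i \<noteq> 0" "i \<noteq> v"
proof (rule ccontr)
  assume "\<not> thesis"
  then have *: "\<And>i. x i \<noteq> 0 \<Longrightarrow> i \<in> {v}" using that by blast
  then have "(\<Sum>w\<in>{v}. x w) = 1" by (intro sum_superset_support[OF assms(1)]) auto
  then have "x v = 1" by simp
  moreover have "x w = 0" if "w \<noteq> v" for w using *[of w] that by blast
  ultimately have "x = vertex_point v" by (intro ext) (simp add: vertex_point_def)
  then show False using assms(2) by blast
qed

lemma support_near_edge:
  assumes "x \<in> underlying_space K" "x v \<noteq> 0" "x j \<noteq> 0" "v \<noteq> j"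
    and "\<And>k. is_face K v j k \<Longrightarrow> k \<in> s" and "x u \<noteq> 0" "u \<noteq> v" "u \<noteq> j"
  shows "u \<in> s"
proof -
  have "{v, j, u} \<in> K" by (rule support_subset_simplex[OF assms(1)]) (use assms in auto)
  then have "is_face K v j u" using assms by (auto simp: is_face_def)
  then show ?thesis by (rule assms(5))
qed

text \<open>Points of the edge close to \<open>v\<close> lie in the planar chart of
  \<open>v\<close>. If the edge had only one triangle, the coordinates at \<open>v\<close> and at
  the third vertex would map the open star of the edge injectively into the upper half plane and
  send the edge to the boundary line, where no interior point of the image can be.\<close>

lemma interior_vertex_edge:
  assumes "v \<in> interior_vertices K" "adjacent K v j"
  shows "\<exists>k. (v, j, k) \<in> T" "\<exists>k. (j, v, k) \<in> T"
proof -
  have "(\<exists>k. (v, j, k) \<in> T) \<and> (\<exists>k. (j, v, k) \<in> T)"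
  proof (rule ccontr)
    assume neg: "\<not> ?thesis"
    obtain k where k: "is_face K v j k" using edge_in_face[OF assms(2)] .
    have uniq: "k' = k" if "is_face K v j k'" for k'
      using positive_iff[OF that] positive_iff[OF k] neg positive_unique by blast
    have d: "v \<noteq> j" "v \<noteq> k" "j \<noteq> k" using k by (auto simp: is_face_def)
    obtain U W where UW: "openin (top_of_set (underlying_space K)) U" "vertex_point v \<in> U"
      "openin (top_of_set UNIV) (W :: complex set)" "U homeomorphic W"
      using assms(1) unfolding interior_vertices_def locally_modelled_at_def by blast
    obtain t where t: "0 < t" "t < 1" "edge_point v j t \<in> U"
      using vertex_nbhd_meets_edge[OF UW(1,2) assms(2)] by blast
    let ?y = "edge_point v j t"
    have int: "locally_modelled_at (underlying_space K) UNIV ?y"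
      using UW t unfolding locally_modelled_at_def by blast
    let ?O = "{x \<in> underlying_space K. \<forall>w\<in>{v, j}. x w \<noteq> 0}"
    let ?f = "\<lambda>x. Complex (x v) (x k)"
    have O: "openin (top_of_set (underlying_space K)) ?O" by (rule openin_nonzero_coordinates) simp
    have yO: "?y \<in> ?O" using edge_point_in_space[OF assms(2), of t] t d by (auto simp: edge_point_def)
    have "continuous_on ?O ?f"
      by (intro continuous_on_Complex continuous_on_subset[OF continuous_on_product_coordinates subset_UNIV])
    moreover have "inj_on ?f ?O"
    proof (rule inj_onI)
      fix x y assume xy: "x \<in> ?O" "y \<in> ?O" "?f x = ?f y"
      have *: "x j = 1 - x v - x k \<and> (\<forall>w. w \<noteq> v \<and> w \<noteq> j \<and> w \<noteq> k \<longrightarrow> x w = 0)" if x: "x \<in> ?O" for x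
      proof -
        have s: "\<And>u. x u \<noteq> 0 \<Longrightarrow> u \<in> {v, j, k}"
          using support_near_edge[of x v j "{k}"] uniq x d by blast
        then have "(\<Sum>w\<in>{v, j, k}. x w) = 1" using x by (intro sum_superset_support) auto
        then show ?thesis using s d by auto
      qed
      from *[OF xy(1)] *[OF xy(2)] xy(3) show "x = y" by (metis ext complex.inject)
    qed
    ultimately have "?f ?y \<in> interior (?f ` ?O)"
      by (rule modelled_plane_interior_image[OF int O yO])
    then have "0 < Im (?f ?y)"
      by (rule interior_subset_half_plane[rotated]) (use underlying_spaceD(1) in auto)
    then show False using d by (simp add: edge_point_def)
  qed
  then show "\<exists>k. (v, j, k) \<in> T" "\<exists>k. (j, v, k) \<in> T" by blast+
qed

text \<open>Two triangles with a common edge contain an embedded copy of an open subset of the plane. So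
  a vertex all of whose edges have two faces cannot lie on the boundary: otherwise it would be an
  isolated boundary point.\<close>

lemma interior_vertexI:
  assumes v: "v \<in> vertices K"
    and two: "\<And>j. adjacent K v j \<Longrightarrow> (\<exists>k. (v, j, k) \<in> T) \<and> (\<exists>k. (j, v, k) \<in> T)"
  shows "v \<in> interior_vertices K"
proof -
  let ?S = "underlying_space K" and ?p = "vertex_point v"
  have pS: "?p \<in> ?S" using vertex_point_in_space[OF v] .
  obtain U W where UW: "openin (top_of_set ?S) U" "?p \<in> U" "openin (top_of_set closed_half_plane) W" "U homeomorphic W"
    using modelled[OF pS] unfolding locally_modelled_at_def by blast
  obtain \<phi> \<psi> where h: "homeomorphism U W \<phi> \<psi>"
    "\<And>V. openin (top_of_set ?S) V \<Longrightarrow> openin (top_of_set closed_half_plane) (\<phi> ` (U \<inter> V))"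
    "\<And>V. openin (top_of_set closed_half_plane) V \<Longrightarrow> openin (top_of_set ?S) (\<psi> ` (W \<inter> V))"
    by (rule homeomorphic_openE[OF UW(1,3,4)]) (rule that)
  have \<phi>W: "\<phi> x \<in> W" "\<psi> (\<phi> x) = x" if "x \<in> U" for x using h(1) that by (auto simp: homeomorphism_def)
  have WH: "W \<subseteq> closed_half_plane" using UW(3) openin_imp_subset by blast
  have "locally_modelled_at ?S UNIV ?p"
  proof (cases "0 < Im (\<phi> ?p)")
    case True
    let ?W = "W \<inter> {w. 0 < Im w}"
    obtain V where V: "open V" "W = closed_half_plane \<inter> V" using UW(3) by (auto simp: openin_open)
    have "?W = V \<inter> {w. 0 < Im w}" using V by (auto simp: closed_half_plane_def)
    then have "open ?W" using V(1) by (simp add: open_Int open_halfspace_Im_gt)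
    moreover have "openin (top_of_set ?S) (\<psi> ` ?W)"
    proof -
      have "openin (top_of_set closed_half_plane) ?W"
        using \<open>open ?W\<close> WH unfolding openin_open by blast
      from h(3)[OF this] show ?thesis by (simp add: Int_absorb1 flip: Int_assoc)
    qed
    moreover have "\<psi> ` ?W homeomorphic ?W"
    proof -
      have "\<psi> ` ?W \<subseteq> U" using h(1) by (auto simp: homeomorphism_def)
      then have "homeomorphism ?W (\<psi> ` ?W) \<psi> \<phi>"
        by (intro homeomorphism_of_subsets[OF homeomorphism_symD[OF h(1)]]) auto
      then show ?thesis using homeomorphic_def homeomorphic_sym by blast
    qed
    moreover have "?p \<in> \<psi> ` ?W" using \<phi>W[OF UW(2)] True by (metis IntI image_eqI mem_Collect_eq)
    ultimately show ?thesis unfolding locally_modelled_at_def by auto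
  next
    case False
    then have Im0: "Im (\<phi> ?p) = 0" using \<phi>W(1)[OF UW(2)] WH by (auto simp: closed_half_plane_def)
    obtain V where V: "open V" "\<phi> ` (U \<inter> open_star v) = closed_half_plane \<inter> V"
      using h(2)[OF openin_open_star] by (auto simp: openin_open)
    have "\<phi> ?p \<in> V" using V(2) UW(2) vertex_point_in_open_star[OF v] by blast
    then obtain e where e: "e > 0" "ball (\<phi> ?p) e \<subseteq> V" using V(1) open_contains_ball by blast
    \<comment> \<open>Together with \<open>v\<close> the boundary line contains a nearby point
      \<open>y\<close> other than \<open>v\<close>. It lies in the open star of an edge from
      \<open>v\<close> to some \<open>i\<close>, where exactly two triangles meet.\<close>
    have "\<phi> ?p + of_real (e / 2) \<in> V" using e by (auto simp: subset_iff dist_norm)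
    then have "\<phi> ?p + of_real (e / 2) \<in> \<phi> ` (U \<inter> open_star v)"
      unfolding V(2) using Im0 by (simp add: closed_half_plane_def)
    then obtain y where y: "y \<in> U" "y \<in> open_star v" "\<phi> y = \<phi> ?p + of_real (e / 2)" by auto
    then have "y \<noteq> ?p" using e by auto
    have yS: "y \<in> ?S" and yv: "y v \<noteq> 0" using y by (auto simp: open_star_def)
    obtain i where i: "y i \<noteq> 0" "i \<noteq> v" using support_off_vertex[OF yS \<open>y \<noteq> ?p\<close>] .
    then have adj: "adjacent K v i"
      using support_subset_simplex[OF yS, of "{v, i}"] yv by (auto simp: adjacent_def)
    then obtain k l where kl: "(v, i, k) \<in> T" "(i, v, l) \<in> T" using two by blast
    have faces: "is_face K v i k" "is_face K v i l"
      using positive_face[OF kl(1)] positive_face[OF kl(2)] by (auto simp: is_face_def insert_commute)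
    then have d: "v \<noteq> i" "v \<noteq> k" "i \<noteq> k" "v \<noteq> l" "i \<noteq> l" by (auto simp: is_face_def)
    have "k \<noteq> l" using positive_iff[OF faces(1)] kl by auto
    have only: "u \<in> {k, l}" if "is_face K v i u" for u
      using positive_iff[OF that] kl positive_unique by blast
    \<comment> \<open>The two triangles are unfolded along their common edge: \<open>Re w\<close> is
      the coordinate at \<open>v\<close>, and \<open>Im w\<close> the one at \<open>k\<close> or,
      with reversed sign, at \<open>l\<close>. On \<open>?D\<close> the coordinates at
      \<open>v\<close> and \<open>i\<close> are positive.\<close>
    define P where "P w = (\<lambda>u. if u = v then Re w else if u = k then max 0 (Im w)
      else if u = l then max 0 (- Im w) else if u = i then 1 - Re w - \<bar>Im w\<bar> else 0)" for w
    let ?D = "{w. 0 < Re w} \<inter> {w. Re w + \<bar>Im w\<bar> < 1}"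
    have PS: "P w \<in> ?S" if w: "w \<in> ?D" for w
    proof (cases "0 \<le> Im w")
      case True
      have "{v, i, k} \<in> K" using faces by (simp add: is_face_def)
      then show ?thesis
        by (rule underlying_spaceI) (use True w d \<open>k \<noteq> l\<close> in \<open>auto simp: P_def\<close>)
    next
      case False
      have "{v, i, l} \<in> K" using faces by (simp add: is_face_def)
      then show ?thesis
        by (rule underlying_spaceI) (use False w d \<open>k \<noteq> l\<close> in \<open>auto simp: P_def\<close>)
    qed
    have contP: "continuous_on UNIV P"
    proof (rule continuous_on_coordinatewise_then_product)
      show "continuous_on UNIV (\<lambda>w. P w u)" for u
        unfolding P_def by (cases "u = v"; cases "u = k"; cases "u = l"; cases "u = i")
          (simp_all, (intro continuous_intros)+)
    qed
    have injP: "inj P"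
    proof (rule injI)
      fix a b assume "P a = P b"
      then have "P a v = P b v" "P a k = P b k" "P a l = P b l" by auto
      then show "a = b" using d \<open>k \<noteq> l\<close> by (auto simp: P_def complex_eq_iff max_def split: if_splits)
    qed
    define q where "q = Complex (y v) (y k - y l)"
    have supp: "\<And>u. y u \<noteq> 0 \<Longrightarrow> u \<in> {v, i, k, l}"
      using support_near_edge[OF yS yv i(1) i(2)[symmetric] only] by blast
    then have sum: "y v + y i + y k + y l = 1"
      using sum_superset_support[OF yS, of "{v, i, k, l}"] d \<open>k \<noteq> l\<close> by auto
    have kl0: "y k = 0 \<or> y l = 0"
    proof (rule ccontr)
      assume "\<not> ?thesis"
      then have "{v, i, k, l} \<in> K" using support_subset_simplex[OF yS, of "{v, i, k, l}"] yv i by auto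
      then show False using simplex_card[of "{v, i, k, l}"] d \<open>k \<noteq> l\<close> by simp
    qed
    have nn: "0 \<le> y u" for u using underlying_spaceD(1)[OF yS] .
    have qD: "q \<in> ?D"
      using kl0 sum nn[of v] nn[of i] nn[of k] nn[of l] yv i by (auto simp: q_def)
    have Pq: "P q = y"
    proof
      fix u
      consider "u = v" | "u = i" | "u = k" | "u = l" | "u \<notin> {v, i, k, l}" by blast
      then show "P q u = y u"
        using kl0 sum nn[of k] nn[of l] supp[of u] d \<open>k \<noteq> l\<close> by cases (auto simp: P_def q_def)
    qed
    obtain O' where O': "open O'" "U = ?S \<inter> O'" using UW(1) by (auto simp: openin_open)
    let ?D' = "?D \<inter> P -` O'"
    have "open ?D"
      by (intro open_Int open_halfspace_Re_gt open_Collect_less continuous_intros)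
    then have "open ?D'" using O'(1) contP by (simp add: open_Int open_vimage)
    have PU: "P w \<in> U" if "w \<in> ?D'" for w using that PS O' by auto
    have "continuous_on ?D' (\<phi> \<circ> P)"
      using h(1) PU contP
      by (intro continuous_on_compose continuous_on_subset[OF contP]) (auto simp: homeomorphism_def elim: continuous_on_subset)
    moreover have "inj_on (\<phi> \<circ> P) ?D'"
    proof (rule inj_onI)
      fix a b assume ab: "a \<in> ?D'" "b \<in> ?D'" "(\<phi> \<circ> P) a = (\<phi> \<circ> P) b"
      then have "\<psi> (\<phi> (P a)) = \<psi> (\<phi> (P b))" by simp
      then have "P a = P b" unfolding \<phi>W(2)[OF PU[OF ab(1)]] \<phi>W(2)[OF PU[OF ab(2)]] .
      then show "a = b" using injP by (simp add: inj_eq)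
    qed
    ultimately have op: "open ((\<phi> \<circ> P) ` ?D')" using invariance_of_domain \<open>open ?D'\<close> by blast
    have "q \<in> ?D'" using qD Pq y(1) O'(2) by auto
    moreover have "\<phi> y = (\<phi> \<circ> P) q" by (simp add: Pq)
    ultimately have "\<phi> y \<in> (\<phi> \<circ> P) ` ?D'" by (rule image_eqI[rotated])
    moreover have "(\<phi> \<circ> P) ` ?D' \<subseteq> {w. 0 \<le> Im w}"
      using PU \<phi>W(1) WH by (auto simp: closed_half_plane_def)
    \<comment> \<open>The unfolding followed by the chart has an open image inside the half plane
      that contains \<open>\<phi> y\<close>, although \<open>y\<close> was chosen on the boundary
      line.\<close>
    ultimately have "0 < Im (\<phi> y)" using op interior_subset_half_plane interior_open by metis
    then show ?thesis using y(3) Im0 by simp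
  qed
  then show ?thesis using v by (simp add: interior_vertices_def)
qed

text \<open>The chart gives a compact neighbourhood \<open>C\<close> of the vertex. Sets of points
  whose mass on a finite vertex set exceeds \<open>1 - t\<close> cover \<open>C\<close>, and a
  finite subcover sees only finitely many vertices. Basic open sets of the product topology restrict
  only finitely many coordinates, so a point on the edge to some unseen neighbour still lies in
  \<open>C\<close>, yet it is not covered.\<close>

lemma finite_neighbours: "finite {j. adjacent K v j}"
proof (rule ccontr)
  assume inf: "infinite {j. adjacent K v j}"
  let ?S = "underlying_space K" and ?p = "vertex_point v"
  have v: "v \<in> vertices K" using inf adjacent_vertices by (metis (mono_tags, lifting) Collect_empty_eq finite.emptyI)
  have pS: "?p \<in> ?S" using vertex_point_in_space[OF v] .
  obtain U W where UW: "openin (top_of_set ?S) U" "?p \<in> U" "openin (top_of_set closed_half_plane) W" "U homeomorphic W"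
    using modelled[OF pS] unfolding locally_modelled_at_def by blast
  obtain \<phi> \<psi> where h: "homeomorphism U W \<phi> \<psi>"
    "\<And>V. openin (top_of_set ?S) V \<Longrightarrow> openin (top_of_set closed_half_plane) (\<phi> ` (U \<inter> V))"
    "\<And>V. openin (top_of_set closed_half_plane) V \<Longrightarrow> openin (top_of_set ?S) (\<psi> ` (W \<inter> V))"
    by (rule homeomorphic_openE[OF UW(1,3,4)]) (rule that)
  have \<phi>W: "\<phi> x \<in> W" "\<psi> (\<phi> x) = x" if "x \<in> U" for x using h(1) that by (auto simp: homeomorphism_def)
  obtain V where V: "open V" "W = closed_half_plane \<inter> V" using UW(3) by (auto simp: openin_open)
  then obtain e where e: "e > 0" "cball (\<phi> ?p) e \<subseteq> V" using \<phi>W(1)[OF UW(2)] open_contains_cball by blast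
  define C where "C = \<psi> ` (closed_half_plane \<inter> cball (\<phi> ?p) e)"
  have CW: "closed_half_plane \<inter> cball (\<phi> ?p) e \<subseteq> W" using V e by blast
  have "closed closed_half_plane" by (simp add: closed_half_plane_def closed_halfspace_Im_ge)
  then have "compact (closed_half_plane \<inter> cball (\<phi> ?p) e)" by (simp add: closed_Int_compact)
  moreover have "continuous_on W \<psi>" using h(1) by (simp add: homeomorphism_def)
  ultimately have "compact C" unfolding C_def using CW by (meson compact_continuous_image continuous_on_subset)
  have "C \<subseteq> U" using CW h(1) by (auto simp: C_def homeomorphism_def)
  then have CS: "C \<subseteq> ?S" using openin_imp_subset[OF UW(1)] by blast
  have "openin (top_of_set ?S) (\<psi> ` (W \<inter> (closed_half_plane \<inter> ball (\<phi> ?p) e)))"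
    by (intro h(3) openin_open_Int) simp
  then obtain O' where O': "open O'" "\<psi> ` (W \<inter> (closed_half_plane \<inter> ball (\<phi> ?p) e)) = ?S \<inter> O'"
    by (auto simp: openin_open)
  have OC: "?S \<inter> O' \<subseteq> C" unfolding O'(2)[symmetric] C_def by auto
  have "?p \<in> ?S \<inter> O'"
    unfolding O'(2)[symmetric] using \<phi>W[OF UW(2)] V(2) e(1) by (intro image_eqI[of _ _ "\<phi> ?p"]) auto
  then have "?p \<in> O'" by blast
  have Oprod: "openin (product_topology (\<lambda>_. euclidean) UNIV) O'"
    using O'(1) by (simp add: euclidean_product_topology flip: open_openin)
  obtain X where X: "?p \<in> Pi\<^sub>E UNIV X" "\<And>i. openin euclidean (X i)" "finite {i. X i \<noteq> topspace euclidean}" "Pi\<^sub>E UNIV X \<subseteq> O'"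
    using product_topology_open_contains_basis[OF Oprod \<open>?p \<in> O'\<close>] by blast
  have "open (X v)" using X(2)[of v] by (rule open_openin[THEN iffD2])
  moreover have "1 \<in> X v" using PiE_mem[OF X(1), of v] by (simp add: vertex_point_def)
  ultimately obtain d where d: "d > 0" "ball 1 d \<subseteq> X v" by (meson open_contains_ball)
  \<comment> \<open>Small enough for \<open>1 - t\<close> to be admissible at \<open>v\<close>. The
    threshold of the cover is exactly the mass that \<open>edge_point v j t\<close> keeps at
    \<open>v\<close>, so no set missing \<open>j\<close> exceeds it.\<close>
  define t where "t = min (d/2) (1/2)"
  have t: "0 < t" "t < 1" "t < d" using d by (auto simp: t_def)
  then have tX: "1 - t \<in> X v" using d(2) by (auto simp: subset_iff dist_real_def)
  let ?c = "\<lambda>F. {x :: 'v \<Rightarrow> real. 1 - t < (\<Sum>w\<in>F. x w)}"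
  have op: "open (?c F)" for F
    by (intro open_Collect_less continuous_on_sum continuous_on_product_coordinates continuous_on_const)
  have cov: "C \<subseteq> (\<Union>F\<in>{F. finite F}. ?c F)"
  proof
    fix x assume "x \<in> C"
    then have x: "x \<in> ?S" using CS by blast
    have "x \<in> ?c {w. x w \<noteq> 0}" using underlying_spaceD(3)[OF x] t by simp
    moreover have "finite {w. x w \<noteq> 0}" using simplex_finite underlying_spaceD(2)[OF x] .
    ultimately show "x \<in> (\<Union>F\<in>{F. finite F}. ?c F)" by blast
  qed
  obtain \<F> where \<F>: "\<F> \<subseteq> {F. finite F}" "finite \<F>" "C \<subseteq> (\<Union>F\<in>\<F>. ?c F)"
    using compactE_image[OF \<open>compact C\<close> op cov] by metis
  have "finite ({i. X i \<noteq> topspace euclidean} \<union> \<Union>\<F>)" using X(3) \<F> by auto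
  then have inf': "infinite ({j. adjacent K v j} - ({i. X i \<noteq> topspace euclidean} \<union> \<Union>\<F>))"
    using inf by (rule Diff_infinite_finite)
  obtain j where j: "adjacent K v j" "X j = UNIV" "j \<notin> \<Union>\<F>"
  proof -
    obtain j where "j \<in> {j. adjacent K v j} - ({i. X i \<noteq> topspace euclidean} \<union> \<Union>\<F>)"
      using infinite_imp_nonempty[OF inf'] unfolding ex_in_conv[symmetric] by (rule exE)
    then have "adjacent K v j" "X j = UNIV" "j \<notin> \<Union>\<F>" by simp_all
    then show ?thesis by (rule that)
  qed
  have vj: "v \<noteq> j" using j(1) by (simp add: adjacent_def)
  let ?x = "edge_point v j t"
  have "?x u \<in> X u" for u
  proof -
    have "?p u \<in> X u" using X(1) by (auto simp: PiE_iff)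
    then show ?thesis using tX j(2) by (auto simp: edge_point_def vertex_point_def split: if_splits)
  qed
  then have "?x \<in> O'" using X(4) by (auto simp: PiE_iff)
  then have "?x \<in> C" using OC edge_point_in_space[OF j(1), of t] t by auto
  then obtain F where F: "F \<in> \<F>" "1 - t < (\<Sum>w\<in>F. ?x w)" using \<F>(3) by auto
  have "(\<Sum>w\<in>F. ?x w) = (\<Sum>w\<in>F. if w = v then 1 - t else 0)"
    using j(3) F(1) by (intro sum.cong) (auto simp: edge_point_def)
  also have "\<dots> \<le> 1 - t" using \<F>(1) F(1) t by (auto simp: sum.delta)
  finally show False using F(2) by simp
qed

text \<open>A half disc stays connected when a point is removed, so a small neighbourhood of
  \<open>v\<close> without \<open>v\<close> is connected. If no triangle at \<open>v\<close> joined
  \<open>X\<close> to the other neighbours, the points with a nonzero coordinate in \<open>X\<close>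
  and those with one outside would separate it.\<close>

lemma link_connected:
  assumes sub: "X \<subseteq> {j. adjacent K v j}" and "X \<noteq> {}"
    and closed: "\<And>j k. is_face K v j k \<Longrightarrow> j \<in> X \<Longrightarrow> k \<in> X"
  shows "X = {j. adjacent K v j}"
proof (rule ccontr)
  assume "X \<noteq> {j. adjacent K v j}"
  then obtain j' where j': "adjacent K v j'" "j' \<notin> X" using sub by blast
  obtain j where j: "adjacent K v j" "j \<in> X" using sub \<open>X \<noteq> {}\<close> by blast
  let ?S = "underlying_space K" and ?p = "vertex_point v"
  have v: "v \<in> vertices K" using j adjacent_vertices by blast
  have pS: "?p \<in> ?S" using vertex_point_in_space[OF v] .
  obtain U W where UW: "openin (top_of_set ?S) U" "?p \<in> U" "openin (top_of_set closed_half_plane) W" "U homeomorphic W"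
    using modelled[OF pS] unfolding locally_modelled_at_def by blast
  obtain \<phi> \<psi> where h: "homeomorphism U W \<phi> \<psi>"
    "\<And>V. openin (top_of_set ?S) V \<Longrightarrow> openin (top_of_set closed_half_plane) (\<phi> ` (U \<inter> V))"
    "\<And>V. openin (top_of_set closed_half_plane) V \<Longrightarrow> openin (top_of_set ?S) (\<psi> ` (W \<inter> V))"
    by (rule homeomorphic_openE[OF UW(1,3,4)]) (rule that)
  have \<phi>W: "\<phi> x \<in> W" "\<psi> (\<phi> x) = x" if "x \<in> U" for x using h(1) that by (auto simp: homeomorphism_def)
  have \<psi>U: "\<psi> w \<in> U" "\<phi> (\<psi> w) = w" if "w \<in> W" for w using h(1) that by (auto simp: homeomorphism_def)
  let ?w = "\<phi> ?p"
  obtain V where V: "open V" "\<phi> ` (U \<inter> open_star v) = closed_half_plane \<inter> V"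
    using h(2)[OF openin_open_star] by (auto simp: openin_open)
  have wV: "?w \<in> V" "0 \<le> Im ?w" using V(2) UW(2) vertex_point_in_open_star[OF v] by (auto simp: closed_half_plane_def)
  then obtain e where e: "e > 0" "ball ?w e \<subseteq> V" using V(1) open_contains_ball by blast
  let ?B = "closed_half_plane \<inter> ball ?w e"
  have B: "b \<in> W \<and> \<psi> b \<in> open_star v" if "b \<in> ?B" for b
  proof -
    have "b \<in> \<phi> ` (U \<inter> open_star v)" using that V(2) e(2) by blast
    then show ?thesis using \<phi>W by auto
  qed
  have "convex ?B" by (simp add: convex_Int closed_half_plane_def convex_halfspace_Im_ge)
  \<comment> \<open>A convex set minus a point stays path connected if it is not contained in a
    line.\<close>
  have ncol: "\<not> collinear ?B"
  proof
    assume "collinear ?B"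
    then have "collinear {?w, ?w + of_real (e/2), ?w + \<i> * of_real (e/2)}"
      by (rule collinear_subset) (use e(1) wV(2) in \<open>auto simp: closed_half_plane_def dist_norm norm_mult\<close>)
    then have "collinear {0, of_real (e/2), \<i> * complex_of_real (e/2)}"
      using collinear_3[of "?w + of_real (e/2)" ?w "?w + \<i> * of_real (e/2)"] by (simp add: insert_commute)
    then show False using e(1) by (auto simp: collinear_lemma complex_eq_iff)
  qed
  have "connected (?B - {?w})"
    by (intro path_connected_imp_connected path_connected_convex_diff_countable \<open>convex ?B\<close> ncol) simp
  moreover have "continuous_on (?B - {?w}) \<psi>"
    using h(1) B by (auto simp: homeomorphism_def elim: continuous_on_subset)
  ultimately have conn: "connected (\<psi> ` (?B - {?w}))" by (rule connected_continuous_image[rotated])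
  define N where "N = {j. adjacent K v j}"
  define A where "A Y = (\<Union>i\<in>Y. {x :: 'v \<Rightarrow> real. x i \<noteq> 0})" for Y
  have openA: "open (A Y)" for Y
    unfolding A_def by (intro open_UN ballI open_Collect_neq continuous_on_product_coordinates continuous_on_const)
  have cover: "\<psi> ` (?B - {?w}) \<subseteq> A X \<union> A (N - X)"
  proof
    fix x assume "x \<in> \<psi> ` (?B - {?w})"
    then obtain b where b: "b \<in> ?B" "b \<noteq> ?w" "x = \<psi> b" by blast
    then have x: "x \<in> ?S" "x v \<noteq> 0" using B[of b] by (auto simp: open_star_def)
    have "\<phi> x = b" using B[OF b(1)] \<psi>U(2) b(3) by blast
    then have "x \<noteq> ?p" using b(2) by blast
    obtain i where i: "x i \<noteq> 0" "i \<noteq> v" using support_off_vertex[OF x(1) \<open>x \<noteq> ?p\<close>] .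
    then have "i \<in> N" using support_subset_simplex[OF x(1), of "{v, i}"] x by (auto simp: N_def adjacent_def)
    then show "x \<in> A X \<union> A (N - X)" using i by (auto simp: A_def)
  qed
  have disj: "A X \<inter> A (N - X) \<inter> \<psi> ` (?B - {?w}) = {}"
  proof (rule ccontr)
    assume "\<not> ?thesis"
    then obtain b i i' where b: "b \<in> ?B" "\<psi> b i \<noteq> 0" "\<psi> b i' \<noteq> 0" "i \<in> X" "i' \<in> N" "i' \<notin> X"
      unfolding A_def by blast
    have x: "\<psi> b \<in> ?S" "\<psi> b v \<noteq> 0" using B[OF b(1)] by (auto simp: open_star_def)
    have "{v, i, i'} \<in> K" using support_subset_simplex[OF x(1), of "{v, i, i'}"] x b by auto
    then have "is_face K v i i'" using b sub by (auto simp: is_face_def N_def adjacent_def)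
    then show False using closed b by blast
  qed
  have "openin (top_of_set ?S) (\<psi> ` (W \<inter> ?B))" by (intro h(3) openin_open_Int) simp
  moreover have "?p \<in> \<psi> ` (W \<inter> ?B)"
    using \<phi>W[OF UW(2)] e(1) wV by (intro image_eqI[of _ _ ?w]) (auto simp: closed_half_plane_def)
  ultimately have meets: "\<psi> ` (?B - {?w}) \<inter> A Y \<noteq> {}" if iY: "i \<in> Y" "adjacent K v i" for i Y
  proof -
    obtain t where t: "0 < t" "t < 1" "edge_point v i t \<in> \<psi> ` (W \<inter> ?B)"
      using vertex_nbhd_meets_edge[OF \<open>openin _ (\<psi> ` (W \<inter> ?B))\<close> \<open>?p \<in> \<psi> ` (W \<inter> ?B)\<close> iY(2)] by blast
    then obtain b where b: "b \<in> ?B" "edge_point v i t = \<psi> b" by blast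
    have vi: "v \<noteq> i" using iY(2) by (simp add: adjacent_def)
    have "edge_point v i t i \<noteq> ?p i" using t vi by (auto simp: edge_point_def vertex_point_def)
    then have "b \<noteq> ?w" using b \<phi>W(2)[OF UW(2)] by metis
    moreover have "\<psi> b \<in> A Y" using iY(1) t vi b(2)[symmetric] by (auto simp: A_def edge_point_def)
    ultimately show ?thesis using b(1) by blast
  qed
  have "j' \<in> N - X" using j' by (simp add: N_def)
  then show False
    using connectedD[OF conn openA openA disj cover] meets[OF j(2) j(1)] meets[OF _ j'(1)] by blast
qed

end

section \<open>Deformations\<close>

locale realized_mesh = mesh K T for K :: "'v set set" and T +
  fixes z :: "'v \<Rightarrow> complex"
  assumes realization: "realization K z"
begin

lemma noncollinear_face: "is_face K i j k \<Longrightarrow> \<not> collinear {z i, z j, z k}"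
  using realization by (simp add: realization_def)

lemma adjacent_distinct_image: "adjacent K v j \<Longrightarrow> z v \<noteq> z j"
  using edge_in_face noncollinear_face by (metis collinear_2 insert_absorb2)

lemma left_apex_eq: "(i, j, k) \<in> T \<Longrightarrow> left_apex T i j = k"
  unfolding left_apex_def by (rule the_equality) (auto dest: positive_unique)

text \<open>One edge at a time, because the local deformations are conformal only within the star of
  one vertex.\<close>

definition conformal_edge :: "('v \<Rightarrow> real) \<Rightarrow> ('v \<Rightarrow> complex) \<Rightarrow> 'v \<Rightarrow> 'v \<Rightarrow> bool" where
  "conformal_edge h d i j \<longleftrightarrow> Re ((d j - d i) / (z j - z i)) = (h i + h j) / 2"

definition angular_velocity :: "('v \<Rightarrow> complex) \<Rightarrow> 'v \<Rightarrow> 'v \<Rightarrow> real" where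
  "angular_velocity d i j = Im ((d j - d i) / (z j - z i))"

text \<open>The change of angular velocity from the edge \<open>v j\<close> to the edge
  \<open>v k\<close> that conformality of the opposite edge prescribes. The two cotangents belong to
  the angles at \<open>k\<close> and at \<open>j\<close>.\<close>

definition angular_jump :: "('v \<Rightarrow> real) \<Rightarrow> 'v \<Rightarrow> 'v \<Rightarrow> 'v \<Rightarrow> real" where
  "angular_jump h v j k = (cot (signed_angle (z v) (z j) (z k)) * (h j - h v)
     + cot (signed_angle (z k) (z v) (z j)) * (h k - h v)) / 2"

lemma conformal_edge_sym: "conformal_edge h d i j \<Longrightarrow> conformal_edge h d j i"
  unfolding conformal_edge_def by (metis add.commute minus_diff_eq minus_divide_divide)

lemma angular_velocity_sym: "angular_velocity d i j = angular_velocity d j i"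
  unfolding angular_velocity_def by (metis minus_diff_eq minus_divide_divide)

lemma conformal_deformation_iff:
  "conformal_deformation K z d h \<longleftrightarrow> (\<forall>i j. adjacent K i j \<longrightarrow> conformal_edge h d i j)"
  by (simp add: conformal_deformation_def conformal_edge_def)

lemma conformal_edge_expand:
  assumes "conformal_edge h d i j" "z i \<noteq> z j"
  shows "d j = d i + (z j - z i) * (of_real ((h i + h j) / 2) + \<i> * of_real (angular_velocity d i j))"
proof -
  have "of_real ((h i + h j) / 2) + \<i> * of_real (angular_velocity d i j) = (d j - d i) / (z j - z i)"
    using assms(1) by (simp add: conformal_edge_def angular_velocity_def complex_eq_iff)
  then show ?thesis using assms(2) by simp
qed

lemma conformal_edge_third_iff:
  assumes f: "is_face K v j k" and "conformal_edge h d v j" "conformal_edge h d v k"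
  shows "conformal_edge h d j k \<longleftrightarrow>
    angular_velocity d v k = angular_velocity d v j + angular_jump h v j k"
proof -
  have "z v \<noteq> z j" "z v \<noteq> z k" using face_adjacent[OF f] adjacent_distinct_image by blast+
  note * = third_side_conformal_iff[OF noncollinear_face[OF f]
      conformal_edge_expand[OF assms(2) this(1)] conformal_edge_expand[OF assms(3) this(2)]]
  show ?thesis unfolding conformal_edge_def angular_jump_def by (rule *)
qed

lemma rigid_face:
  assumes "is_face K v j k" "conformal_edge (\<lambda>_. 0) d v j" "conformal_edge (\<lambda>_. 0) d v k" "conformal_edge (\<lambda>_. 0) d j k"
  shows "angular_velocity d v k = angular_velocity d v j"
  using conformal_edge_third_iff[OF assms(1-3)] assms(4) by (simp add: angular_jump_def)

lemma conformal_edge_diff: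
  assumes "conformal_edge h d i j" "conformal_edge h d' i j"
  shows "conformal_edge (\<lambda>_. 0) (\<lambda>v. d' v - d v) i j"
proof -
  have "(d' j - d j - (d' i - d i)) / (z j - z i) = (d' j - d' i) / (z j - z i) - (d j - d i) / (z j - z i)"
    by (simp add: algebra_simps flip: diff_divide_distrib)
  then show ?thesis using assms by (simp add: conformal_edge_def)
qed

lemma interior_left_apex:
  assumes "v \<in> interior_vertices K" "adjacent K v j"
  shows "(v, j, left_apex T v j) \<in> T" "(j, v, left_apex T j v) \<in> T"
  using interior_vertex_edge[OF assms] left_apex_eq by metis+

text \<open>Turning by one triangle around an interior vertex; the right apex turns back.\<close>

lemma bij_left_apex:
  assumes "v \<in> interior_vertices K"
  shows "bij_betw (left_apex T v) {j. adjacent K v j} {j. adjacent K v j}"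
proof (rule bij_betw_byWitness[where f' = "\<lambda>j. left_apex T j v"])
  have "(left_apex T v j, v, j) \<in> T" if "adjacent K v j" for j
    using interior_left_apex(1)[OF assms that] positive_rotate by blast
  then show "\<forall>j\<in>{j. adjacent K v j}. left_apex T (left_apex T v j) v = j"
    using left_apex_eq by blast
  have "(v, left_apex T j v, j) \<in> T" if "adjacent K v j" for j
    using interior_left_apex(2)[OF assms that] positive_rotate by blast
  then show "\<forall>j\<in>{j. adjacent K v j}. left_apex T v (left_apex T j v) = j"
    using left_apex_eq by blast
  show "left_apex T v ` {j. adjacent K v j} \<subseteq> {j. adjacent K v j}"
    using interior_left_apex(1)[OF assms] positive_face face_adjacent by blast
  show "(\<lambda>j. left_apex T j v) ` {j. adjacent K v j} \<subseteq> {j. adjacent K v j}"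
    using interior_left_apex(2)[OF assms] positive_face face_adjacent by blast
qed

text \<open>Each cotangent of the Laplacian at \<open>v\<close> belongs to a triangle at \<open>v\<close>; collecting the terms by
  triangles instead of edges gives the jumps.\<close>

lemma sum_angular_jump:
  assumes "v \<in> interior_vertices K"
  shows "(\<Sum>j | adjacent K v j. angular_jump h v j (left_apex T v j))
    = (\<Sum>j | adjacent K v j. cot_weight T z v j * (h j - h v)) / 2"
proof -
  let ?N = "{j. adjacent K v j}" and ?s = "left_apex T v"
  let ?g = "\<lambda>j. cot (signed_angle (z j) (z v) (z (left_apex T j v))) * (h j - h v)"
  have inv: "left_apex T (?s j) v = j" if "j \<in> ?N" for j
    using interior_left_apex(1)[OF assms, of j] that positive_rotate left_apex_eq by blast
  have "(\<Sum>j\<in>?N. cot_weight T z v j * (h j - h v))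
      = (\<Sum>j\<in>?N. cot (signed_angle (z v) (z j) (z (?s j))) * (h j - h v)) + (\<Sum>j\<in>?N. ?g j)"
    by (simp add: cot_weight_def Let_def distrib_right sum.distrib)
  also have "(\<Sum>j\<in>?N. ?g j) = (\<Sum>j\<in>?N. ?g (?s j))"
    using sum.reindex_bij_betw[OF bij_left_apex[OF assms], of ?g] by simp
  also have "\<dots> = (\<Sum>j\<in>?N. cot (signed_angle (z (?s j)) (z v) (z j)) * (h (?s j) - h v))"
    by (rule sum.cong) (use inv in auto)
  finally show ?thesis
    by (simp add: angular_jump_def sum.distrib flip: sum_divide_distrib)
qed

text \<open>The jumps are differences of angular velocities along a permutation of the neighbours,
  so they add up to 0.\<close>

lemma conformal_imp_harmonic:
  assumes "conformal_deformation K z d h"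
  shows "cot_harmonic K T z h"
  unfolding cot_harmonic_def
proof
  fix v assume v: "v \<in> interior_vertices K"
  let ?N = "{j. adjacent K v j}" and ?s = "left_apex T v" and ?w = "angular_velocity d v"
  have "angular_jump h v j (?s j) = ?w (?s j) - ?w j" if "j \<in> ?N" for j
  proof -
    have f: "is_face K v j (?s j)" using interior_left_apex(1)[OF v] that positive_face by blast
    then show ?thesis
      using conformal_edge_third_iff[OF f, of h d] face_adjacent[OF f] assms by (simp add: conformal_deformation_iff)
  qed
  then have "(\<Sum>j\<in>?N. angular_jump h v j (?s j)) = (\<Sum>j\<in>?N. ?w (?s j)) - (\<Sum>j\<in>?N. ?w j)"
    by (simp add: sum_subtractf)
  also have "\<dots> = 0" using sum.reindex_bij_betw[OF bij_left_apex[OF v], of ?w] by simp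
  finally show "(\<Sum>j\<in>?N. cot_weight T z v j * (h j - h v)) = 0"
    using sum_angular_jump[OF v, of h] by simp
qed

text \<open>With \<open>v\<close> kept fixed, the unknowns are the angular velocities
  \<open>f\<close> of the edges at \<open>v\<close>. Conformality of the opposite edges is a
  difference equation along the link; it has a closing condition only if the link is a cycle, and
  that condition is harmonicity at \<open>v\<close>.\<close>

lemma local_deformation:
  assumes harm: "cot_harmonic K T z h" and v: "v \<in> vertices K"
  obtains d where "\<And>i j. {v, i, j} \<in> K \<Longrightarrow> i \<noteq> j \<Longrightarrow> conformal_edge h d i j"
proof -
  define N where "N = {j. adjacent K v j}"
  let ?s = "left_apex T v"
  define D where "D = {j. \<exists>k. (v, j, k) \<in> T}"
  have s: "(v, j, ?s j) \<in> T" if "j \<in> D" for j using that left_apex_eq by (auto simp: D_def)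
  have DN: "D \<subseteq> N" unfolding D_def N_def using face_adjacent(1)[OF positive_face] by blast
  have sN: "?s ` D \<subseteq> N" unfolding N_def using face_adjacent(3)[OF positive_face[OF s]] by blast
  have inj: "inj_on ?s D"
  proof (rule inj_onI)
    fix i j assume ij: "i \<in> D" "j \<in> D" "?s i = ?s j"
    then have "(?s i, v, i) \<in> T" "(?s i, v, j) \<in> T" using s positive_rotate by metis+
    then show "i = j" by (rule positive_unique)
  qed
  obtain f where f: "\<And>j. j \<in> D \<Longrightarrow> f (?s j) = f j + angular_jump h v j (?s j)"
  proof (rule partial_cycle_difference_equation[OF _ DN inj sN])
    show "finite N" unfolding N_def by (rule finite_neighbours)
  next
    fix X assume X: "X \<subseteq> N" "X \<noteq> {}" and closed: "\<And>j. j \<in> D \<Longrightarrow> j \<in> X \<longleftrightarrow> ?s j \<in> X"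
    show "X = N"
      unfolding N_def
    proof (rule link_connected)
      fix j k assume f: "is_face K v j k" and j: "j \<in> X"
      show "k \<in> X"
      proof (cases "(v, j, k) \<in> T")
        case True
        then show ?thesis using closed[of j] j left_apex_eq by (auto simp: D_def)
      next
        case False
        then have "(v, k, j) \<in> T" using positive_iff[OF f] positive_rotate by blast
        then show ?thesis using closed[of k] j left_apex_eq by (auto simp: D_def)
      qed
    qed (use X in \<open>auto simp: N_def\<close>)
  next
    \<comment> \<open>If every edge at \<open>v\<close> has a left triangle, turning is an injective
      self-map of a finite set and hence onto. So every edge has a right triangle as well, and
      \<open>v\<close> is interior.\<close>
    assume tot: "D = N"
    have "?s ` N = N"
      using endo_inj_surj[OF finite_neighbours, of ?s v] sN inj tot by (simp add: N_def)
    have "v \<in> interior_vertices K"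
    proof (rule interior_vertexI[OF v])
      fix j assume "adjacent K v j"
      then have "j \<in> D" "j \<in> ?s ` D" using \<open>?s ` N = N\<close> tot by (auto simp: N_def)
      then obtain i where "(v, i, j) \<in> T" using s by blast
      then show "(\<exists>k. (v, j, k) \<in> T) \<and> (\<exists>k. (j, v, k) \<in> T)"
        using \<open>j \<in> D\<close> positive_rotate[OF positive_rotate] unfolding D_def by blast
    qed
    then show "(\<Sum>j\<in>N. angular_jump h v j (?s j)) = 0"
      using sum_angular_jump[of v h] harm by (simp add: N_def cot_harmonic_def)
  qed (rule that)
  define d where "d j = (z j - z v) * (of_real ((h v + h j) / 2) + \<i> * of_real (f j))" for j
  have d: "conformal_edge h d v j" "angular_velocity d v j = f j" if "adjacent K v j" for j
    using adjacent_distinct_image[OF that] by (auto simp: conformal_edge_def angular_velocity_def d_def)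
  have pos: "conformal_edge h d j k" if "(v, j, k) \<in> T" for j k
  proof -
    have "f k = f j + angular_jump h v j k" using f[of j] that left_apex_eq by (auto simp: D_def)
    moreover have F: "is_face K v j k" using that by (rule positive_face)
    ultimately show ?thesis
      using conformal_edge_third_iff[OF F d(1) d(1)] face_adjacent[OF F] d(2) by simp
  qed
  have "conformal_edge h d i j" if ij: "{v, i, j} \<in> K" "i \<noteq> j" for i j
  proof -
    consider "i = v" | "j = v" | "is_face K v i j" using ij by (auto simp: is_face_def)
    then show ?thesis
    proof cases
      case 1
      then show ?thesis using ij d(1) by (simp add: adjacent_def)
    next
      case 2
      then have "adjacent K v i" using ij by (simp add: adjacent_def insert_commute)
      then show ?thesis using 2 d(1) conformal_edge_sym by blast
    next
      case 3
      show ?thesis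
      proof (cases "(v, i, j) \<in> T")
        case False
        then have "(v, j, i) \<in> T" using positive_iff[OF 3] positive_rotate by blast
        then show ?thesis using pos conformal_edge_sym by blast
      qed (rule pos)
    qed
  qed
  then show ?thesis using that by blast
qed

lemma harmonic_imp_conformal:
  assumes sc: "simply_connected (underlying_space K)" and harm: "cot_harmonic K T z h"
  obtains d where "conformal_deformation K z d h"
proof -
  \<comment> \<open>The pair consists of an angular velocity and a translation. \<open>triv\<close>
    is additive in it, so successive corrections become sums in one abelian group.\<close>
  define triv :: "real \<times> complex \<Rightarrow> 'v \<Rightarrow> complex"
    where "triv g u = \<i> * of_real (fst g) * z u + snd g" for g u
  have "\<exists>d. \<forall>i j. {v, i, j} \<in> K \<longrightarrow> i \<noteq> j \<longrightarrow> conformal_edge h d i j" if "v \<in> vertices K" for v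
    using local_deformation[OF harm that] by metis
  then obtain L where L: "\<And>v i j. v \<in> vertices K \<Longrightarrow> {v, i, j} \<in> K \<Longrightarrow> i \<noteq> j \<Longrightarrow> conformal_edge h (L v) i j"
    by metis
  \<comment> \<open>All triangles common to the two stars contain the edge from \<open>v\<close> to
    \<open>w\<close>. Its angular velocity \<open>\<alpha>\<close> fixes the rigid motion on each of
    them, so one \<open>g\<close> serves for all.\<close>
  have "\<exists>g. \<forall>u. {u, v, w} \<in> K \<longrightarrow> L w u = L v u + triv g u" if vw: "{v, w} \<in> K" for v w
  proof (cases "v = w")
    case True
    then show ?thesis by (intro exI[of _ 0]) (simp add: triv_def)
  next
    case False
    then have adj: "adjacent K v w" using vw by (simp add: adjacent_def)
    then have V: "v \<in> vertices K" "w \<in> vertices K" using adjacent_vertices by blast+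
    have zvw: "z v \<noteq> z w" using adjacent_distinct_image[OF adj] .
    let ?d = "\<lambda>u. L w u - L v u"
    define \<alpha> where "\<alpha> = angular_velocity ?d v w"
    have rig: "conformal_edge (\<lambda>_. 0) ?d i j" if "{v, i, j} \<in> K" "{w, i, j} \<in> K" "i \<noteq> j" for i j
      using L V that conformal_edge_diff by blast
    have w: "?d w = ?d v + (z w - z v) * (\<i> * of_real \<alpha>)"
      using conformal_edge_expand[OF rig[of v w] zvw] vw False by (simp add: \<alpha>_def insert_commute)
    have "?d u = ?d v + (z u - z v) * (\<i> * of_real \<alpha>)" if u: "{u, v, w} \<in> K" for u
    proof -
      consider "u = v" | "u = w" | "is_face K v w u" using u False by (auto simp: is_face_def insert_commute)
      then show ?thesis
      proof cases
        case 3
        have e: "conformal_edge (\<lambda>_. 0) ?d i j" if "i \<in> {u, v, w}" "j \<in> {u, v, w}" "i \<noteq> j" for i j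
          using that u simplex_subset[OF u] by (intro rig) auto
        have "angular_velocity ?d v u = \<alpha>"
          unfolding \<alpha>_def by (rule rigid_face[OF 3]) (use 3 in \<open>auto intro!: e simp: is_face_def\<close>)
        moreover have "z v \<noteq> z u" using face_adjacent(3)[OF 3] adjacent_distinct_image by blast
        moreover have "v \<noteq> u" using 3 by (auto simp: is_face_def)
        ultimately show ?thesis using conformal_edge_expand[OF e[of v u]] by simp
      qed (use w in simp_all)
    qed
    then have "L w u = L v u + triv (\<alpha>, ?d v - \<i> * of_real \<alpha> * z v) u" if "{u, v, w} \<in> K" for u
      using that by (simp add: triv_def algebra_simps)
    then show ?thesis by blast
  qed
  then obtain G where G: "\<And>u v w. {v, w} \<in> K \<Longrightarrow> {u, v, w} \<in> K \<Longrightarrow> L w u = L v u + triv (G v w) u"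
    by metis
  have "G u v + G v w = G u w" if uvw: "{u, v, w} \<in> K" for u v w
  proof -
    \<comment> \<open>The triple may be degenerate, while a rigid motion is determined by its values
      at two distinct points; hence the passage to a full triangle.\<close>
    obtain a b c where F: "is_face K a b c" "{u, v, w} \<subseteq> {a, b, c}" using simplex_in_face[OF uvw] .
    have zab: "z a \<noteq> z b" by (rule adjacent_distinct_image[OF face_adjacent(1)[OF F(1)]])
    have sub: "s \<in> K" if "s \<subseteq> {a, b, c}" "s \<noteq> {}" for s
      using simplex_subset[of "{a, b, c}" s] F(1) that by (simp add: is_face_def)
    have *: "triv (G u v + G v w - G u w) x = 0" if x: "x \<in> {a, b, c}" for x
    proof -
      have "L v x = L u x + triv (G u v) x" "L w x = L v x + triv (G v w) x" "L w x = L u x + triv (G u w) x"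
        by (rule G; rule sub; use F(2) x in simp)+
      then show ?thesis by (simp add: triv_def algebra_simps)
    qed
    define p where "p = G u v + G v w - G u w"
    have "triv p a = 0" "triv p b = 0" using *[of a] *[of b] by (auto simp: p_def)
    moreover have "\<i> * of_real (fst p) * (z a - z b) = triv p a - triv p b"
      by (simp add: triv_def algebra_simps)
    ultimately have "\<i> * of_real (fst p) * (z a - z b) = 0" by simp
    then have "fst p = 0" using zab by simp
    moreover from this have "snd p = 0" using \<open>triv p a = 0\<close> by (simp add: triv_def)
    ultimately have "p = 0" by (simp add: prod_eq_iff)
    then show ?thesis by (simp add: p_def)
  qed
  then obtain a where a: "\<And>v w. {v, w} \<in> K \<Longrightarrow> G v w = a w - a v"
    using closed_cochain_exact[OF sc, of G] by blast
  \<comment> \<open>Each corrected deformation is evaluated only at its own centre. At a neighbour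
    \<open>w\<close> the result agrees with the corrected \<open>L v\<close>, because
    \<open>G v w = a w - a v\<close>.\<close>
  define d where "d v = L v v - triv (a v) v" for v
  have "conformal_edge h d v w" if vw: "adjacent K v w" for v w
  proof -
    have K: "{v, w} \<in> K" "v \<noteq> w" using vw by (auto simp: adjacent_def)
    have zvw: "z w - z v \<noteq> 0" using adjacent_distinct_image[OF vw] by simp
    have "L w w = L v w + triv (a w - a v) w" using G[of v w w] a K by (simp add: insert_commute)
    then have "d w = L v w - triv (a v) w" by (simp add: d_def triv_def algebra_simps)
    then have "d w - d v = (L v w - L v v) - \<i> * of_real (fst (a v)) * (z w - z v)"
      by (simp add: d_def triv_def algebra_simps)
    then have "(d w - d v) / (z w - z v) = (L v w - L v v) / (z w - z v) - \<i> * of_real (fst (a v))"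
      using zvw by (simp add: diff_divide_distrib)
    moreover have "conformal_edge h (L v) v w" using L[of v v w] K adjacent_vertices[OF vw] by simp
    ultimately show ?thesis by (simp add: conformal_edge_def)
  qed
  then have "conformal_deformation K z d h" by (simp add: conformal_deformation_iff)
  then show ?thesis by (rule that)
qed

text \<open>The difference of two solutions has scale change 0, so it moves triangles rigidly. As
  links are connected, all edges at a vertex share one angular velocity, and each edge passes it on
  to its other end; the translation part is then constant along edges, too.\<close>

lemma conformal_unique:
  assumes "conformal_deformation K z d h" "conformal_deformation K z d' h"
  shows "\<exists>\<theta>::real. \<exists>c. \<forall>v\<in>vertices K. d' v = d v + (\<i> * of_real \<theta> * z v + c)"
proof (cases "vertices K = {}")
  case False
  then obtain v0 where v0: "v0 \<in> vertices K" by blast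
  define e where "e v = d' v - d v" for v
  have e: "conformal_edge (\<lambda>_. 0) e i j" if "adjacent K i j" for i j
    unfolding e_def using assms that by (intro conformal_edge_diff) (auto simp: conformal_deformation_iff)
  have same: "angular_velocity e v j = angular_velocity e v j'" if j: "adjacent K v j" and j': "adjacent K v j'" for v j j'
  proof -
    let ?X = "{k. adjacent K v k \<and> angular_velocity e v k = angular_velocity e v j}"
    have "?X = {k. adjacent K v k}"
    proof (rule link_connected)
      fix k l assume f: "is_face K v k l" and k: "k \<in> ?X"
      have "angular_velocity e v l = angular_velocity e v k"
        using rigid_face[OF f] face_adjacent[OF f] e by blast
      then show "l \<in> ?X" using k face_adjacent[OF f] by simp
    qed (use j in auto)
    then show ?thesis using j' by (metis (mono_tags, lifting) mem_Collect_eq)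
  qed
  define \<theta> where "\<theta> v = angular_velocity e v (SOME j. adjacent K v j)" for v
  have \<theta>: "\<theta> v = angular_velocity e v j" if "adjacent K v j" for v j
    unfolding \<theta>_def using same someI[of "adjacent K v" j] that by blast
  define q where "q v = (\<theta> v, e v - \<i> * of_real (\<theta> v) * z v)" for v
  have "q v = q w" if vw: "adjacent K v w" for v w
  proof -
    have eq: "\<theta> v = \<theta> w" using \<theta>[OF vw] \<theta>[OF adjacent_sym[OF vw]] angular_velocity_sym by metis
    have "e w = e v + (z w - z v) * (\<i> * of_real (\<theta> v))"
      using conformal_edge_expand[OF e[OF vw] adjacent_distinct_image[OF vw]] \<theta>[OF vw] by simp
    then show ?thesis using eq by (simp add: q_def algebra_simps)
  qed
  then have "q v = q v0" if "v \<in> vertices K" for v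
    using constant_along_edges[OF connected_space _ that v0] by blast
  then have "d' v = d v + (\<i> * of_real (fst (q v0)) * z v + snd (q v0))" if "v \<in> vertices K" for v
    using that by (auto simp: q_def e_def algebra_simps prod_eq_iff)
  then show ?thesis by blast
qed auto

end

lemma pattern_deformation_rotate:
  "pattern_deformation K z (\<lambda>v. \<i> * d v) h \<longleftrightarrow> conformal_deformation K z d h"
proof -
  have "Im ((\<i> * d j - \<i> * d i) / (z j - z i)) = Re ((d j - d i) / (z j - z i))" for i j
  proof -
    have "(\<i> * d j - \<i> * d i) / (z j - z i) = \<i> * ((d j - d i) / (z j - z i))"
      by (simp add: right_diff_distrib)
    then show ?thesis by (simp only: Im_i_times)
  qed
  then show ?thesis by (simp add: pattern_deformation_def conformal_deformation_def)
qed

theorem theorem3p6: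
  fixes K :: "'v set set"
    and T :: "('v \<times> 'v \<times> 'v) set"
    and z :: "'v \<Rightarrow> complex"
    and h :: "'v \<Rightarrow> real"
  assumes "triangular_mesh K T"
    and "simply_connected (underlying_space K)"
    and "realization K z"
  defines "A \<equiv> cot_harmonic K T z h"
    and "B \<equiv>
      (\<exists>zdot. conformal_deformation K z zdot h) \<and>
      (\<forall>zdot zdot'. conformal_deformation K z zdot h \<and> conformal_deformation K z zdot' h \<longrightarrow>
         (\<exists>\<theta>::real. \<exists>c. \<forall>v\<in>vertices K. zdot' v = zdot v + (\<i> * of_real \<theta> * z v + c)))"
    and "C \<equiv>
      (\<exists>zdot. pattern_deformation K z (\<lambda>v. \<i> * zdot v) h) \<and>
      (\<forall>zdot zdot'. pattern_deformation K z (\<lambda>v. \<i> * zdot v) h \<and>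
                    pattern_deformation K z (\<lambda>v. \<i> * zdot' v) h \<longrightarrow>
         (\<exists>r::real. \<exists>c. \<forall>v\<in>vertices K. \<i> * zdot' v = \<i> * zdot v + (of_real r * z v + c)))"
  shows "(A \<longleftrightarrow> B) \<and> (B \<longleftrightarrow> C)"
proof -
  interpret realized_mesh K T z
    using assms(1,3) by unfold_locales
  have A: "A \<longleftrightarrow> (\<exists>d. conformal_deformation K z d h)"
    unfolding A_def using conformal_imp_harmonic harmonic_imp_conformal[OF assms(2)] by metis
  have B: "B \<longleftrightarrow> (\<exists>d. conformal_deformation K z d h)"
    unfolding B_def using conformal_unique by blast
  have "\<exists>r::real. \<exists>c. \<forall>v\<in>vertices K. \<i> * d' v = \<i> * d v + (of_real r * z v + c)"
    if dd': "conformal_deformation K z d h" "conformal_deformation K z d' h" for d d'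
  proof -
    obtain \<theta> :: real and c where "\<forall>v\<in>vertices K. d' v = d v + (\<i> * of_real \<theta> * z v + c)"
      using conformal_unique[OF dd'] by blast
    \<comment> \<open>Multiplication by \<open>\<i>\<close> turns the rotation with velocity
      \<open>\<theta>\<close> into the scaling by \<open>- \<theta>\<close>.\<close>
    then have "\<forall>v\<in>vertices K. \<i> * d' v = \<i> * d v + (of_real (- \<theta>) * z v + \<i> * c)"
      by (simp add: algebra_simps)
    then show ?thesis by blast
  qed
  then have C: "C \<longleftrightarrow> (\<exists>d. conformal_deformation K z d h)"
    unfolding C_def pattern_deformation_rotate by blast
  show ?thesis using A B C by blast
qed

end
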